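(* (Outperformance option.) In the two-dimensional Black–Scholes model of the context let $H=(\max\{S^1_T,S^2_T\}-K)^+$ with $K>0$, and let $c\ge0$. (linear loss) $$\Psi_1(c)=\int_{a_1}^{+\infty}\int_b^{+\infty}\left(S^1_0e^{(\alpha_1-\frac12\sigma_1^2)T+\sigma_1x}-K\right)\mathbf 1_{\{A_1x+A_2\frac{\sigma_1x-z}{\sigma_2}\ge\ln c-BT\}}f_{W^1_T,\sigma_1W^1_T-\sigma_2W^2_T}(x,z)\,dz\,dx$$ $$+\int_{a_2}^{+\infty}\int_{-\infty}^b\left(S^2_0e^{(\alpha_2-\frac12\sigma_2^2)T+\sigma_2y}-K\right)\mathbf 1_{\{A_1\frac{z+\sigma_2y}{\sigma_1}+A_2y\ge\ln c-BT\}}f_{W^2_T,\sigma_1W^1_T-\sigma_2W^2_T}(y,z)\,dz\,dy,$$ $$\Psi_2(c)=\int_{\tilde a_1}^{+\infty}\int_{\tilde b}^{+\infty}\left(S^1_0e^{(r-\frac12\sigma_1^2)T+\sigma_1x}-K\right)\mathbf 1_{\{A_1x+A_2\frac{\sigma_1x-z}{\sigma_2}\ge\ln c-\tilde BT\}}\tilde f_{\widetilde W^1_T,\sigma_1\widetilde W^1_T-\sigma_2\widetilde W^2_T}(x,z)\,dz\,dx$$ $$+\int_{\tilde a_2}^{+\infty}\int_{-\infty}^{\tilde b}\left(S^2_0e^{(r-\frac12\sigma_2^2)T+\sigma_2y}-K\right)\mathbf 1_{\{A_1\frac{z+\sigma_2y}{\sigma_1}+A_2y\ge\ln c-\tilde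 BT\}}\tilde f_{\widetilde W^2_T,\sigma_1\widetilde W^1_T-\sigma_2\widetilde W^2_T}(y,z)\,dz\,dy.$$ (power loss, $p>1$) Consider the case $A_1>0$, $A_2>0$, and set $$v_1(x)=-\tfrac1{A_2}\left(A_1x+BT+\ln\left(\tfrac1c\left(S^1_0e^{(\alpha_1-\frac12\sigma_1^2)T+\sigma_1x}-K\right)^{p}\right)\right),$$ $$v_2(x)=-\tfrac1{A_1}\left(A_2x+BT+\ln\left(\tfrac1c\left(S^2_0e^{(\alpha_2-\frac12\sigma_2^2)T+\sigma_2x}-K\right)^{p}\right)\right),$$ $$\tilde v_1(x)=-\tfrac1{A_2}\left(A_1x+\tilde BT+\ln\left(\tfrac1c\left(S^1_0e^{(r-\frac12\sigma_1^2)T+\sigma_1x}-K\right)^{p}\right)\right),$$ $$\tilde v_2(x)=-\tfrac1{A_1}\left(A_2x+\tilde BT+\ln\left(\tfrac1c\left(S^2_0e^{(r-\frac12\sigma_2^2)T+\sigma_2x}-K\right)^{p}\right)\right).$$ Then, with the convention that the integral over the empty set is zero, $$\Psi^p_1(c)=\frac1p\int_{a_1}^{+\infty}\int_{-\infty}^{v_1(x)\wedge\frac{\sigma_1x-b}{\sigma_2}}\left(S^1_0e^{(\alpha_1-\frac12\sigma_1^2)T+\sigma_1x}-K\right)^pf_{W^2_T\mid W^1_T=x}(y)\,dy\,f_{W^1_T}(x)\,dx$$ $$+\frac1pc^{\frac p{p-1}}e^{-\frac{pBT}{p-1}}\int_{a_1}^{+\infty}\int_{v_1(x)}^{\frac{\sigma_1x-b}{\sigma_2}}e^{-\frac{pA_1}{p-1}x-\frac{pA_2}{p-1}y}f_{W^2_T\mid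 W^1_T=x}(y)\,dy\,f_{W^1_T}(x)\,dx$$ $$+\frac1p\int_{a_2}^{+\infty}\int_{-\infty}^{v_2(x)\wedge\frac{\sigma_2x-b}{\sigma_1}}\left(S^2_0e^{(\alpha_2-\frac12\sigma_2^2)T+\sigma_2x}-K\right)^pf_{W^1_T\mid W^2_T=x}(y)\,dy\,f_{W^2_T}(x)\,dx$$ $$+\frac1pc^{\frac p{p-1}}e^{-\frac{pBT}{p-1}}\int_{a_2}^{+\infty}\int_{v_2(x)}^{\frac{\sigma_2x-b}{\sigma_1}}e^{-\frac{pA_1}{p-1}x-\frac{pA_2}{p-1}y}f_{W^1_T\mid W^2_T=x}(y)\,dy\,f_{W^2_T}(x)\,dx,$$ $$\Psi^p_2(c)=\int_{\tilde a_1}^{+\infty}\int_{\tilde v_1(x)}^{\frac{\sigma_1x-\tilde b}{\sigma_2}}\left(S^1_0e^{(r-\frac12\sigma_1^2)T+\sigma_1x}-K\right)\tilde f_{\widetilde W^2_T\mid\widetilde W^1_T=x}(y)\,dy\,\tilde f_{\widetilde W^1_T}(x)\,dx$$ $$-c^{\frac1{p-1}}e^{-\frac{\tilde B}{p-1}T}\int_{\tilde a_1}^{+\infty}\int_{\tilde v_1(x)}^{\frac{\sigma_1x-\tilde b}{\sigma_2}}e^{-\frac{A_1}{p-1}x-\frac{A_2}{p-1}y}\tilde f_{\widetilde W^2_T\mid\widetilde W^1_T=x}(y)\,dy\,\tilde f_{\widetilde W^1_T}(x)\,dx$$ $$+\int_{\tilde a_2}^{+\infty}\int_{\tilde v_2(x)}^{\frac{\sigma_2x-\tilde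 b}{\sigma_1}}\left(S^2_0e^{(r-\frac12\sigma_2^2)T+\sigma_2x}-K\right)\tilde f_{\widetilde W^1_T\mid\widetilde W^2_T=x}(y)\,dy\,\tilde f_{\widetilde W^2_T}(x)\,dx$$ $$-c^{\frac1{p-1}}e^{-\frac{\tilde B}{p-1}T}\int_{\tilde a_2}^{+\infty}\int_{\tilde v_2(x)}^{\frac{\sigma_2x-\tilde b}{\sigma_1}}e^{-\frac{A_1}{p-1}x-\frac{A_2}{p-1}y}\tilde f_{\widetilde W^1_T\mid\widetilde W^2_T=x}(y)\,dy\,\tilde f_{\widetilde W^2_T}(x)\,dx.$$
   Context: Model. $T>0$; $(W^1,W^2)$ is a Wiener process under $P$ with positive definite correlation matrix $Q=\begin{pmatrix}1&\rho\\\rho&1\end{pmatrix}$. Stocks $dS^i_t=S^i_t(\alpha_i\,dt+\sigma_i\,dW^i_t)$, $i=1,2$, with $\alpha_i\in\mathbb R$, $\sigma_i>0$, and constant interest rate $r$. Let $\theta_i=\frac{\alpha_i-r}{\sigma_i}$, $\theta=(\theta_1,\theta_2)^T$, $\widetilde W^i_t=W^i_t+\theta_it$. The martingale measure $\tilde P$ has density $\tilde Z_T=e^{-A_1W^1_T-A_2W^2_T-BT}=e^{-A_1\widetilde W^1_T-A_2\widetilde W^2_T-\tilde BT}$ with respect to $P$, where $(A_1,A_2)^T=Q^{-1}\theta$, $B=\frac12|Q^{-1/2}\theta|^2$, $\tilde B=B-A_1\theta_1-A_2\theta_2$; under $\tilde P$, $\widetilde W=(\widetilde W^1,\widetilde W^2)$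 is a Wiener process with correlation matrix $Q$. $\mathbf E,\tilde{\mathbf E}$ are expectations under $P,\tilde P$; $f$ denotes (joint, conditional) densities under $P$ and $\tilde f$ under $\tilde P$. Constants ($i=1,2$): $a_i=\frac1{\sigma_i}\left(\ln\frac K{S^i_0}-(\alpha_i-\frac12\sigma_i^2)T\right)$, $\tilde a_i=\frac1{\sigma_i}\left(\ln\frac K{S^i_0}-(r-\frac12\sigma_i^2)T\right)$, $b=\ln\frac{S^2_0}{S^1_0}+\left(\alpha_2-\alpha_1-\frac12(\sigma_2^2-\sigma_1^2)\right)T$, $\tilde b=\ln\frac{S^2_0}{S^1_0}-\frac12(\sigma_2^2-\sigma_1^2)T$. Risk auxiliary functions. Linear loss $l(x)=x$: $\Psi_1(c)=\mathbf E[H\mathbf 1_{\{\tilde Z_T^{-1}\ge c\}}]$, $\Psi_2(c)=\tilde{\mathbf E}[H\mathbf 1_{\{\tilde Z_T^{-1}\ge c\}}]$. Power loss $l(x)=x^p/p$, $p>1$: with $\varphi_c:=\left\{1-\left(\frac{(c\tilde Z_T)^{1/(p-1)}}{H}\wedge1\right)\right\}\mathbf 1_{\{H>0\}}$, $\Psi^p_1(c)=\frac1p\mathbf E[((1-\varphi_c)H)^p]$ and $\Psi^p_2(c)=\tilde{\mathbf E}[H\varphi_c]$. Convention: $\ln0=-\infty$.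
   Formalization: Power loss corrected: exponent p in the logarithms of v_i, ṽ_i is p−1; in terms conditioned on W²_T=x (or W̃²_T=x) the bound is (σ2x+b)/σ1 (b̃ likewise) and the exponent uses A1y+A2x. Stocks are taken in explicit geometric Brownian form. *)

theory Defs
  imports "HOL-Probability.Probability"
begin

section \<open>Matrices\<close>

definition corr_matrix :: "real \<Rightarrow> real^2^2" where
  "corr_matrix \<rho> = vector [vector [1, \<rho>], vector [\<rho>, 1]]"

definition pos_def :: "real^'n^'n \<Rightarrow> bool" where
  "pos_def M \<longleftrightarrow> transpose M = M \<and> (\<forall>x. x \<noteq> 0 \<longrightarrow> 0 < x \<bullet> (M *v x))"

text \<open>$Q^{-1/2}$: the positive definite square root of the inverse (it is unique).\<close>

definition inv_sqrt_matrix :: "real^'n^'n \<Rightarrow> real^'n^'n" where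
  "inv_sqrt_matrix Q = (SOME R. pos_def R \<and> R ** R = matrix_inv Q)"


section \<open>Correlated Wiener processes\<close>

definition gaussian_density :: "real^'n^'n \<Rightarrow> real^'n \<Rightarrow> real" where
  "gaussian_density C x =
     exp (- (x \<bullet> (matrix_inv C *v x)) / 2) / sqrt ((2 * pi) ^ CARD('n) * det C)"

text \<open>The increments over $[s,t]$ have the law $N(0, (t-s)Q)$. Only the time
  interval $[0,T]$ of the market is considered.\<close>

definition wiener_process_2d ::
  "'a measure \<Rightarrow> real^2^2 \<Rightarrow> real \<Rightarrow> (real \<Rightarrow> 'a \<Rightarrow> real) \<Rightarrow> (real \<Rightarrow> 'a \<Rightarrow> real) \<Rightarrow> bool" where
  "wiener_process_2d P Q T W1 W2 \<longleftrightarrow>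
     prob_space P \<and>
     (\<forall>t\<in>{0..T}. W1 t \<in> borel_measurable P \<and> W2 t \<in> borel_measurable P) \<and>
     (AE \<omega> in P. W1 0 \<omega> = 0 \<and> W2 0 \<omega> = 0) \<and>
     (AE \<omega> in P. continuous_on {0..T} (\<lambda>t. W1 t \<omega>) \<and> continuous_on {0..T} (\<lambda>t. W2 t \<omega>)) \<and>
     (\<forall>(n::nat) \<tau>. mono_on {..n} \<tau> \<and> \<tau> ` {..n} \<subseteq> {0..T} \<longrightarrow>
        prob_space.indep_vars P (\<lambda>_. borel)
          (\<lambda>k \<omega>. (W1 (\<tau> (Suc k)) \<omega> - W1 (\<tau> k) \<omega>, W2 (\<tau> (Suc k)) \<omega> - W2 (\<tau> k) \<omega>)) {..<n}) \<and>
     (\<forall>s t. 0 \<le> s \<and> s < t \<and> t \<le> T \<longrightarrow>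
        distributed P lborel (\<lambda>\<omega>. (W1 t \<omega> - W1 s \<omega>, W2 t \<omega> - W2 s \<omega>))
          (\<lambda>(x, y). ennreal (gaussian_density ((t - s) *\<^sub>R Q) (vector [x, y]))))"


section \<open>Stock prices\<close>

definition bs_price :: "real \<Rightarrow> real \<Rightarrow> real \<Rightarrow> real \<Rightarrow> real \<Rightarrow> real" where
  "bs_price s \<mu> \<sigma> t x = s * exp ((\<mu> - \<sigma>\<^sup>2 / 2) * t + \<sigma> * x)"

text \<open>The solution of $dS_t = S_t(\alpha\,dt + \sigma\,dW_t)$, $S_0 = s$. There is no
  stochastic integral in the library, so the explicit solution serves as the definition.\<close>

definition stock :: "real \<Rightarrow> real \<Rightarrow> real \<Rightarrow> (real \<Rightarrow> 'a \<Rightarrow> real) \<Rightarrow> real \<Rightarrow> 'a \<Rightarrow> real" where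
  "stock s \<alpha> \<sigma> W t \<omega> = bs_price s \<alpha> \<sigma> t (W t \<omega>)"


section \<open>Densities of random variables\<close>

definition rv_density :: "'a measure \<Rightarrow> ('a \<Rightarrow> 'b::euclidean_space) \<Rightarrow> 'b \<Rightarrow> real" where
  "rv_density P X x = enn2real (RN_deriv lborel (distr P lborel X) x)"

definition joint_density ::
  "'a measure \<Rightarrow> ('a \<Rightarrow> real) \<Rightarrow> ('a \<Rightarrow> real) \<Rightarrow> real \<Rightarrow> real \<Rightarrow> real" where
  "joint_density P X Y x y = rv_density P (\<lambda>\<omega>. (X \<omega>, Y \<omega>)) (x, y)"

text \<open>\<open>cond_density P Y X x y\<close> is $f_{Y \mid X = x}(y)$.\<close>

definition cond_density ::
  "'a measure \<Rightarrow> ('a \<Rightarrow> real) \<Rightarrow> ('a \<Rightarrow> real) \<Rightarrow> real \<Rightarrow> real \<Rightarrow> real" where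
  "cond_density P Y X x y = joint_density P X Y x y / rv_density P X x"


section \<open>Risk auxiliary functions\<close>

text \<open>\<open>P\<close> is the original measure, \<open>P'\<close> the martingale measure and \<open>Z\<close> the density of
  \<open>P'\<close> with respect to \<open>P\<close>.\<close>

definition Psi1 :: "'a measure \<Rightarrow> ('a \<Rightarrow> real) \<Rightarrow> ('a \<Rightarrow> real) \<Rightarrow> real \<Rightarrow> real" where
  "Psi1 P Z H c = (\<integral>\<omega>. H \<omega> * indicator {\<omega>. inverse (Z \<omega>) \<ge> c} \<omega> \<partial>P)"

definition Psi2 :: "'a measure \<Rightarrow> ('a \<Rightarrow> real) \<Rightarrow> ('a \<Rightarrow> real) \<Rightarrow> real \<Rightarrow> real" where
  "Psi2 P' Z H c = (\<integral>\<omega>. H \<omega> * indicator {\<omega>. inverse (Z \<omega>) \<ge> c} \<omega> \<partial>P')"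

definition phi :: "real \<Rightarrow> ('a \<Rightarrow> real) \<Rightarrow> ('a \<Rightarrow> real) \<Rightarrow> real \<Rightarrow> 'a \<Rightarrow> real" where
  "phi p Z H c \<omega> =
     (1 - min ((c * Z \<omega>) powr (1 / (p - 1)) / H \<omega>) 1) * indicator {\<omega>. H \<omega> > 0} \<omega>"

definition Psi1p :: "real \<Rightarrow> 'a measure \<Rightarrow> ('a \<Rightarrow> real) \<Rightarrow> ('a \<Rightarrow> real) \<Rightarrow> real \<Rightarrow> real" where
  "Psi1p p P Z H c = 1 / p * (\<integral>\<omega>. ((1 - phi p Z H c \<omega>) * H \<omega>) powr p \<partial>P)"

definition Psi2p :: "real \<Rightarrow> 'a measure \<Rightarrow> ('a \<Rightarrow> real) \<Rightarrow> ('a \<Rightarrow> real) \<Rightarrow> real \<Rightarrow> real" where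
  "Psi2p p P' Z H c = (\<integral>\<omega>. H \<omega> * phi p Z H c \<omega> \<partial>P')"


section \<open>Extended logarithm and the boundary curves of the power loss\<close>

text \<open>The logarithm with $\ln 0 = -\infty$ and $\ln(+\infty) = +\infty$; the library's
  \<^const>\<open>ln\<close> has \<open>ln 0 = 0\<close>. On \<^typ>\<open>ereal\<close> one has \<open>1 / 0 = \<infinity>\<close>, which is what $1/c$ has to
  mean for \<open>c = 0\<close>.\<close>

definition eln :: "ereal \<Rightarrow> ereal" where
  "eln x = (if x \<le> 0 then -\<infinity> else if x = \<infinity> then \<infinity> else ereal (ln (real_of_ereal x)))"

text \<open>With \<open>g x\<close> the pay-off at \<open>W\<^sup>i = x\<close>, the curve
  $v(x) = -\frac{1}{A'}\bigl(Ax + BT + \ln(\frac1c\, g(x)^{p-1})\bigr)$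
  is the set on which $(cZ)^{1/(p-1)} = H$, as $Z = e^{-Ax - A'y - BT}$.
  The source prints the exponent $p$ in place of $p-1$; with $p$ the curve does
  not separate the two cases of the minimum in \<open>phi\<close>, and the formulas for
  \<open>Psi1p\<close> and \<open>Psi2p\<close> are false. In the two terms that are conditioned on
  $W^2_T = x$ (integration variable $y$ for $W^1_T$) the source also prints the bound
  $(\sigma_2 x - b)/\sigma_1$ and the exponent $-\frac{p}{p-1}(A_1 x + A_2 y)$, and likewise under
  the martingale measure; $S^2_T > S^1_T$ means $\sigma_1 y - \sigma_2 x < b$, so the correct bound is
  $(\sigma_2 x + b)/\sigma_1$, and $Z$ contributes $A_1 y + A_2 x$.\<close>

definition boundary ::
  "real \<Rightarrow> real \<Rightarrow> real \<Rightarrow> real \<Rightarrow> real \<Rightarrow> real \<Rightarrow> (real \<Rightarrow> real) \<Rightarrow> real \<Rightarrow> ereal" where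
  "boundary A A' B T p c g x =
     ereal (- (1 / A')) * (ereal (A * x + B * T) + eln (1 / ereal c * ereal (g x powr (p - 1))))"

end

(* Gaussianity enters only through two properties of the pair (W1_T, W2_T): its law is absolutely
   continuous and all its exponential moments are finite. Both survive swapping the components,
   translation and an exponential change of measure, hence they also hold for the shifted pair under
   the martingale measure. The pay-off is split along the null set S1_T = S2_T, each half is split
   along the boundary curve (again a null set, being the graph of a function), and each piece is
   an integral against a joint or a conditional density by Fubini. *)
theory Submission
  imports Defs
begin

text \<open>The densities in the statement are Radon-Nikodym derivatives, hence known only up to
  null sets, and they are never compared with an explicit Gaussian formula. What is proved is that
  arbitrary versions integrate correctly; a conditional density enters only multiplied by its
  marginal, where points with marginal density 0 do no harm. A Bochner integral of a non-integrable
  function is 0, so every splitting into summands needs integrability of each piece. Pay-offs, their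
  powers and the powers of Z are all bounded by exponentials of linear forms in the two variables,
  which is why exponential moments of all orders are demanded. The descriptions by (drifts
  \<alpha>1, \<alpha>2, constant B, measure P) and by (drift r, constant B', measure P') have the
  same algebraic shape. Each formula is therefore proved once for free drifts and a free constant,
  and then instantiated.\<close>

section \<open>Pairs of random variables with an absolutely continuous joint law\<close>

text \<open>\<open>rv_density\<close> passes through \<open>enn2real\<close>, which would send the
  value \<infinity> to 0. The law of X is finite, so the Radon-Nikodym derivative is finite almost
  everywhere and nothing is lost.\<close>

lemma distr_rv_density:
  fixes X :: "'a \<Rightarrow> 'b::euclidean_space"
  assumes "finite_measure M" and [measurable]: "X \<in> borel_measurable M"
    and null: "\<And>N. N \<in> null_sets lborel \<Longrightarrow> AE \<omega> in M. X \<omega> \<notin> N"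
  shows "distr M lborel X = density lborel (\<lambda>x. ennreal (rv_density M X x))"
proof -
  interpret finite_measure M by fact
  let ?N = "distr M lborel X"
  interpret N: finite_measure ?N by (rule finite_measure_distr) simp
  have ac: "absolutely_continuous lborel ?N"
    unfolding absolutely_continuous_def
  proof
    fix N :: "'b set" assume N: "N \<in> null_sets lborel"
    then have [measurable]: "N \<in> sets borel" by auto
    have "AE x in ?N. x \<notin> N"
      using null[OF N] by (subst AE_distr_iff) auto
    then show "N \<in> null_sets ?N" by (subst AE_iff_null_sets) auto
  qed
  have "AE x in lborel. RN_deriv lborel ?N x \<noteq> \<infinity>"
    by (intro sigma_finite_measure.RN_deriv_finite[OF sigma_finite_lborel] ac N.sigma_finite_measure_axioms) simp
  then have "density lborel (\<lambda>x. ennreal (rv_density M X x)) = density lborel (RN_deriv lborel ?N)"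
    by (intro density_cong) (auto simp: rv_density_def less_top elim!: eventually_mono)
  also have "\<dots> = ?N"
    by (rule sigma_finite_measure.density_RN_deriv[OF sigma_finite_lborel ac]) simp
  finally show ?thesis by simp
qed

lemma rv_density_nonneg [simp]: "0 \<le> rv_density M X x"
  by (simp add: rv_density_def)

lemma joint_density_nonneg [simp]: "0 \<le> joint_density M U V x y"
  by (simp add: joint_density_def)

lemma borel_measurable_rv_density [measurable]: "rv_density M X \<in> borel_measurable borel"
  unfolding rv_density_def by measurable

lemma borel_measurable_joint_density [measurable]:
  "(\<lambda>(x, y). joint_density M U V x y) \<in> borel_measurable (borel \<Otimes>\<^sub>M borel)"
  unfolding joint_density_def borel_prod by (simp add: case_prod_unfold)

lemma sets_Collect_lborel_pair:
  assumes "Measurable.pred (borel \<Otimes>\<^sub>M borel) (\<lambda>(x, y). P x y)"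
  shows "{p \<in> space (lborel \<Otimes>\<^sub>M lborel). P (fst p) (snd p)} \<in> sets (lborel \<Otimes>\<^sub>M lborel)"
proof -
  have "{p \<in> space (borel \<Otimes>\<^sub>M borel). (\<lambda>(x, y). P x y) p} \<in> sets (borel \<Otimes>\<^sub>M borel)"
    using assms by (simp add: pred_def)
  moreover have "sets (lborel \<Otimes>\<^sub>M lborel) = sets (borel \<Otimes>\<^sub>M borel)"
    by (intro sets_pair_measure_cong) auto
  ultimately show ?thesis
    by (simp add: space_pair_measure case_prod_unfold)
qed

lemma AE_lborel_commute:
  fixes P :: "'a::euclidean_space \<Rightarrow> 'b::euclidean_space \<Rightarrow> bool"
  assumes "Measurable.pred (borel \<Otimes>\<^sub>M borel) (\<lambda>(x, y). P x y)"
  shows "(AE x in lborel. AE y in lborel. P x y) \<longleftrightarrow> (AE y in lborel. AE x in lborel. P x y)"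
  by (rule lborel_pair.AE_commute) (rule sets_Collect_lborel_pair[OF assms])

lemma null_sets_pairD:
  assumes "N \<in> null_sets (lborel :: (real \<times> real) measure)"
  shows "N \<in> sets (borel \<Otimes>\<^sub>M borel)" and "AE x in lborel. AE y in lborel. (x, y) \<notin> N"
proof -
  show "N \<in> sets (borel \<Otimes>\<^sub>M borel)"
    using null_setsD2[OF assms] unfolding borel_prod by simp
  have "AE p in lborel \<Otimes>\<^sub>M lborel. (p :: real \<times> real) \<notin> N"
    using assms by (simp add: lborel_prod AE_not_in)
  from lborel_pair.AE_pair[OF this] show "AE x in lborel. AE y in lborel. (x, y) \<notin> N" .
qed

text \<open>The measure is only finite, not a probability, so that densities of the form exp(linear
  + constant) stay inside the locale without any normalisation. \<open>null\<close> is absolute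
  continuity of the joint law, phrased as avoidance of null sets.\<close>

locale ac_pair = finite_measure M for M :: "'a measure" +
  fixes U V :: "'a \<Rightarrow> real"
  assumes meas [measurable]: "U \<in> borel_measurable M" "V \<in> borel_measurable M"
    and null: "\<And>N. N \<in> null_sets (lborel :: (real \<times> real) measure) \<Longrightarrow> AE \<omega> in M. (U \<omega>, V \<omega>) \<notin> N"
begin

text \<open>The iterated form of the hypothesis lets null sets in the plane be treated one line at a
  time, so that coordinate changes reduce to one-dimensional affine maps.\<close>

lemma AE_ac:
  assumes [measurable]: "Measurable.pred (borel \<Otimes>\<^sub>M borel) (\<lambda>(x, y). R x y)"
    and ae: "AE x in lborel. AE y in lborel. R x y"
  shows "AE \<omega> in M. R (U \<omega>) (V \<omega>)"
proof -
  let ?N = "{(x, y). \<not> R x y} :: (real \<times> real) set"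
  have [measurable]: "?N \<in> sets (borel \<Otimes>\<^sub>M borel)"
  proof -
    have "{p \<in> space (borel \<Otimes>\<^sub>M borel). \<not> (\<lambda>(x, y). R x y) p} \<in> sets (borel \<Otimes>\<^sub>M borel)"
      by measurable
    then show ?thesis by (simp add: space_pair_measure case_prod_unfold)
  qed
  have "AE p in lborel \<Otimes>\<^sub>M lborel. p \<notin> ?N"
    using ae sets_Collect_lborel_pair[OF assms(1)]
    by (intro lborel_pair.AE_pair_measure) (simp_all add: case_prod_unfold)
  then have "?N \<in> null_sets lborel"
    unfolding lborel_prod by (subst AE_iff_null_sets) (simp_all flip: borel_prod)
  from null[OF this] show ?thesis by simp
qed

text \<open>Every vertical slice of a graph is a single point. This removes both the line where the
  two prices agree and the boundary curves.\<close>

lemma AE_neq_graph: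
  assumes [measurable]: "f \<in> borel_measurable borel"
  shows "AE \<omega> in M. V \<omega> \<noteq> f (U \<omega>)"
  by (rule AE_ac) (auto intro: AE_lborel_singleton)

lemma ac_pair_swap: "ac_pair M V U"
proof
  fix N :: "(real \<times> real) set" assume N: "N \<in> null_sets lborel"
  from null_sets_pairD(1)[OF N] have [measurable]: "N \<in> sets (borel \<Otimes>\<^sub>M borel)" .
  from null_sets_pairD(2)[OF N] have "AE y in lborel. AE x in lborel. (x, y) \<notin> N"
    by (subst (asm) AE_lborel_commute) simp_all
  then show "AE \<omega> in M. (V \<omega>, U \<omega>) \<notin> N"
    by (intro AE_ac) auto
qed auto

text \<open>On each vertical line the map is affine with slope w, hence preserves null sets when w
  is nonzero. It supplies the pairs with second component \<sigma>1 U - \<sigma>2 V.\<close>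

lemma ac_pair_shear:
  assumes "w \<noteq> 0"
  shows "ac_pair M U (\<lambda>\<omega>. u * U \<omega> + w * V \<omega>)"
proof
  fix N :: "(real \<times> real) set" assume N: "N \<in> null_sets lborel"
  from null_sets_pairD(1)[OF N] have [measurable]: "N \<in> sets (borel \<Otimes>\<^sub>M borel)" .
  from null_sets_pairD(2)[OF N] have "AE x in lborel. AE y in lborel. (x, u * x + w * y) \<notin> N"
    by eventually_elim (rule AE_borel_affine, use assms in auto)
  then show "AE \<omega> in M. (U \<omega>, u * U \<omega> + w * V \<omega>) \<notin> N"
    by (intro AE_ac) auto
qed auto

text \<open>The two coordinates are translated in turn, with the order of the two AE quantifiers
  exchanged in between. Translations are written \<open>t + 1 * y\<close> to be instances of the
  affine lemma. A density can only create further null sets.\<close>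

lemma ac_pair_translate_density:
  assumes [measurable]: "Z \<in> borel_measurable M" and "finite_measure (density M Z)"
  shows "ac_pair (density M Z) (\<lambda>\<omega>. U \<omega> + s) (\<lambda>\<omega>. V \<omega> + t)"
proof -
  interpret D: finite_measure "density M Z" by fact
  show ?thesis
  proof
    fix N :: "(real \<times> real) set" assume N: "N \<in> null_sets lborel"
    from null_sets_pairD(1)[OF N] have [measurable]: "N \<in> sets (borel \<Otimes>\<^sub>M borel)" .
    from null_sets_pairD(2)[OF N] have "AE x in lborel. AE y in lborel. (x, t + 1 * y) \<notin> N"
      by eventually_elim (rule AE_borel_affine, auto)
    then have "AE y in lborel. AE x in lborel. (x, t + 1 * y) \<notin> N"
      by (subst AE_lborel_commute[symmetric]) simp_all
    then have "AE y in lborel. AE x in lborel. (s + 1 * x, t + 1 * y) \<notin> N"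
      by eventually_elim (rule AE_borel_affine, auto)
    then have "AE x in lborel. AE y in lborel. (s + 1 * x, t + 1 * y) \<notin> N"
      by (subst AE_lborel_commute) simp_all
    then have "AE \<omega> in M. (U \<omega> + s, V \<omega> + t) \<notin> N"
      by (intro AE_ac) (auto simp: add.commute)
    then show "AE \<omega> in density M Z. (U \<omega> + s, V \<omega> + t) \<notin> N"
      by (subst AE_density) auto
  qed auto
qed

section \<open>Expectations as iterated integrals against joint and conditional densities\<close>

lemma distr_joint_density:
  "distr M lborel (\<lambda>\<omega>. (U \<omega>, V \<omega>)) = density lborel (\<lambda>(x, y). ennreal (joint_density M U V x y))"
  unfolding joint_density_def case_prod_unfold prod.collapse
  by (rule distr_rv_density) (auto intro: finite_measure_axioms null)

lemma integral_joint_density: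
  assumes h[measurable]: "(\<lambda>(x, y). h x y) \<in> borel_measurable (borel \<Otimes>\<^sub>M borel)"
    and int: "integrable M (\<lambda>\<omega>. h (U \<omega>) (V \<omega>) :: real)"
  shows "(LBINT x. LBINT y. h x y * joint_density M U V x y) = (\<integral>\<omega>. h (U \<omega>) (V \<omega>) \<partial>M)"
proof -
  have m[measurable]: "(\<lambda>(x, y). h x y) \<in> borel_measurable lborel"
    "(\<lambda>(x, y). joint_density M U V x y) \<in> borel_measurable lborel"
    using h borel_measurable_joint_density[of M U V] by (simp_all add: borel_prod)
  have "(\<integral>\<omega>. h (U \<omega>) (V \<omega>) \<partial>M) = integral\<^sup>L (distr M lborel (\<lambda>\<omega>. (U \<omega>, V \<omega>))) (\<lambda>(x, y). h x y)"
    by (subst integral_distr) auto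
  also have "\<dots> = (\<integral>(x, y). h x y * joint_density M U V x y \<partial>(lborel \<Otimes>\<^sub>M lborel))"
    unfolding distr_joint_density lborel_prod case_prod_unfold using m[unfolded case_prod_unfold]
    by (subst integral_density) (auto simp: mult.commute)
  finally have eq: "(\<integral>\<omega>. h (U \<omega>) (V \<omega>) \<partial>M) = \<dots>" .
  have "integrable (distr M lborel (\<lambda>\<omega>. (U \<omega>, V \<omega>))) (\<lambda>(x, y). h x y)"
    using int by (subst integrable_distr_eq) auto
  then have i: "integrable (lborel \<Otimes>\<^sub>M lborel) (\<lambda>(x, y). h x y * joint_density M U V x y)"
    unfolding distr_joint_density lborel_prod case_prod_unfold using m[unfolded case_prod_unfold]
    by (subst (asm) integrable_density) (auto simp: mult.commute)
  show "(LBINT x. LBINT y. h x y * joint_density M U V x y) = (\<integral>\<omega>. h (U \<omega>) (V \<omega>) \<partial>M)"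
    unfolding eq using lborel_pair.integral_fst'[OF i] by simp
qed

text \<open>Both sides are densities of the law of U, and densities are unique almost everywhere.
  Nothing stronger can hold, since the two derivatives are chosen independently.\<close>

lemma AE_marginal_density:
  "AE x in lborel. ennreal (rv_density M U x) = (\<integral>\<^sup>+y. ennreal (joint_density M U V x y) \<partial>lborel)"
proof -
  let ?j = "\<lambda>x. \<integral>\<^sup>+y. ennreal (joint_density M U V x y) \<partial>lborel"
  have d: "distr M lborel U = density lborel (\<lambda>x. ennreal (rv_density M U x))"
  proof (rule distr_rv_density)
    fix N :: "real set" assume N: "N \<in> null_sets lborel"
    then have [measurable]: "N \<in> sets borel" by auto
    show "AE \<omega> in M. U \<omega> \<notin> N"
      by (rule AE_ac) (use AE_not_in[OF N] in \<open>auto elim!: eventually_mono\<close>)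
  qed (auto intro: finite_measure_axioms)
  have "density lborel ?j = distr M lborel U"
  proof (rule measure_eqI)
    fix A assume "A \<in> sets (density lborel ?j)"
    then have [measurable]: "A \<in> sets borel" by simp
    have "emeasure (distr M lborel U) A = emeasure (distr M lborel (\<lambda>\<omega>. (U \<omega>, V \<omega>))) (A \<times> UNIV)"
      by (subst (1 2) emeasure_distr)
         (auto simp: borel_prod[symmetric] vimage_def intro!: arg_cong[where f="emeasure M"])
    also have "\<dots> = (\<integral>\<^sup>+p. ennreal (joint_density M U V (fst p) (snd p)) * indicator (A \<times> UNIV) p \<partial>(lborel \<Otimes>\<^sub>M lborel))"
      unfolding distr_joint_density lborel_prod
      using borel_measurable_joint_density[of M U V]
      by (subst emeasure_density) (auto simp: borel_prod[symmetric] case_prod_unfold)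
    also have "\<dots> = (\<integral>\<^sup>+x. \<integral>\<^sup>+y. ennreal (joint_density M U V x y) * indicator A x \<partial>lborel \<partial>lborel)"
      by (subst lborel.nn_integral_fst[symmetric]) (auto simp: indicator_times)
    also have "\<dots> = (\<integral>\<^sup>+x. ?j x * indicator A x \<partial>lborel)"
      by (simp add: nn_integral_multc)
    also have "\<dots> = emeasure (density lborel ?j) A"
      by (subst emeasure_density) auto
    finally show "emeasure (density lborel ?j) A = emeasure (distr M lborel U) A" by simp
  qed simp
  with d show ?thesis
    by (intro sigma_finite_measure.density_unique_iff[OF sigma_finite_lborel, THEN iffD1]) auto
qed

lemma AE_cond_density:
  "AE x in lborel. AE y in lborel.
     cond_density M V U x y * rv_density M U x = joint_density M U V x y"
  using AE_marginal_density
proof eventually_elim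
  case (elim x)
  show ?case
  proof (cases "rv_density M U x = 0")
    case True
    \<comment> \<open>here \<open>cond_density\<close> is \<open>joint_density / 0 = 0\<close>, and the joint density vanishes too\<close>
    with elim have "AE y in lborel. ennreal (joint_density M U V x y) = 0"
      by (subst nn_integral_0_iff_AE[symmetric]) auto
    then show ?thesis by eventually_elim (simp add: cond_density_def)
  qed (simp add: cond_density_def)
qed

lemma set_integral_joint_density:
  assumes [measurable]: "A \<in> sets borel" "C \<in> sets borel"
      "(\<lambda>(x, y). h x y) \<in> borel_measurable (borel \<Otimes>\<^sub>M borel)"
    and int: "integrable M (\<lambda>\<omega>. of_bool (U \<omega> \<in> A \<and> V \<omega> \<in> C) * h (U \<omega>) (V \<omega>) :: real)"
  shows "(LBINT x:A. (LBINT y:C. h x y * joint_density M U V x y))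
    = (\<integral>\<omega>. of_bool (U \<omega> \<in> A \<and> V \<omega> \<in> C) * h (U \<omega>) (V \<omega>) \<partial>M)"
proof -
  have "(LBINT x:A. (LBINT y:C. h x y * joint_density M U V x y))
     = (LBINT x. LBINT y. (of_bool (x \<in> A \<and> y \<in> C) * h x y) * joint_density M U V x y)"
    unfolding set_lebesgue_integral_def
    by (intro Bochner_Integration.integral_cong refl) (auto simp: indicator_def mult.assoc)
  also have "\<dots> = (\<integral>\<omega>. of_bool (U \<omega> \<in> A \<and> V \<omega> \<in> C) * h (U \<omega>) (V \<omega>) \<partial>M)"
    by (intro integral_joint_density int) measurable
  finally show ?thesis .
qed

text \<open>The inner region may move with x, as the boundary curves require. The marginal factor is
  pulled into the inner integral, which is legitimate even at points x where that integral does not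
  converge, and there it merges with the conditional density into the joint one.\<close>

lemma set_integral_cond_density:
  assumes [measurable]: "A \<in> sets borel" "Measurable.pred (borel \<Otimes>\<^sub>M borel) (\<lambda>(x, y). y \<in> C x)"
      "(\<lambda>(x, y). h x y) \<in> borel_measurable (borel \<Otimes>\<^sub>M borel)"
    and int: "integrable M (\<lambda>\<omega>. of_bool (U \<omega> \<in> A \<and> V \<omega> \<in> C (U \<omega>)) * h (U \<omega>) (V \<omega>) :: real)"
  shows "(LBINT x:A. (LBINT y:C x. h x y * cond_density M V U x y) * rv_density M U x)
    = (\<integral>\<omega>. of_bool (U \<omega> \<in> A \<and> V \<omega> \<in> C (U \<omega>)) * h (U \<omega>) (V \<omega>) \<partial>M)"
proof -
  let ?h = "\<lambda>x y. of_bool (x \<in> A \<and> y \<in> C x) * h x y"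
  have m[measurable]: "(\<lambda>(x, y). ?h x y) \<in> borel_measurable (borel \<Otimes>\<^sub>M borel)"
    by measurable
  have [measurable]: "(\<lambda>(x, y). cond_density M V U x y) \<in> borel_measurable (borel \<Otimes>\<^sub>M borel)"
    unfolding cond_density_def by measurable
  have "(LBINT x:A. (LBINT y:C x. h x y * cond_density M V U x y) * rv_density M U x)
     = (LBINT x. LBINT y. ?h x y * (cond_density M V U x y * rv_density M U x))"
    unfolding set_lebesgue_integral_def
    by (intro Bochner_Integration.integral_cong refl)
       (auto simp: indicator_def mult.assoc simp flip: integral_mult_left_zero
             intro!: Bochner_Integration.integral_cong)
  also have "\<dots> = (LBINT x. LBINT y. ?h x y * joint_density M U V x y)"
  proof (rule integral_cong_AE)
    show "AE x in lborel. (LBINT y. ?h x y * (cond_density M V U x y * rv_density M U x)) =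
         (LBINT y. ?h x y * joint_density M U V x y)"
      using AE_cond_density
    proof eventually_elim
      case (elim x)
      then show ?case by (intro integral_cong_AE) (auto elim!: eventually_mono)
    qed
  qed measurable
  also have "\<dots> = (\<integral>\<omega>. ?h (U \<omega>) (V \<omega>) \<partial>M)"
    by (intro integral_joint_density m int)
  finally show ?thesis .
qed

end

section \<open>Exponential moments of the Wiener process\<close>

lemma abs_corr_less_1:
  assumes "pos_def (corr_matrix \<rho>)"
  shows "\<bar>\<rho>\<bar> < 1"
proof -
  have *: "0 < x \<bullet> (corr_matrix \<rho> *v x)" if "x \<noteq> 0" for x
    using assms that by (auto simp: pos_def_def)
  \<comment> \<open>These are the eigenvectors of the correlation matrix; the quadratic form takes
    the values 2 + 2\<rho> and 2 - 2\<rho> on them.\<close>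
  have "vector [1, 1] \<noteq> (0 :: real^2)" "vector [1, -1] \<noteq> (0 :: real^2)"
    by (auto simp: vec_eq_iff forall_2)
  from *[OF this(1)] *[OF this(2)] show ?thesis
    by (simp add: corr_matrix_def inner_vec_def sum_2 matrix_vector_mult_def)
qed

text \<open>\<open>matrix_inv\<close> is a choice, so an explicit candidate is identified through
  uniqueness of two-sided inverses.\<close>

lemma matrix_inv_eqI:
  fixes A :: "'a::semiring_1^'n^'m"
  assumes "A ** B = mat 1" "B ** A = mat 1"
  shows "matrix_inv A = B"
  unfolding matrix_inv_def
proof (rule some_equality)
  fix B' assume "A ** B' = mat 1 \<and> B' ** A = mat 1"
  then have "B' = B' ** (A ** B)" by (simp add: assms)
  also have "\<dots> = B"
    using \<open>A ** B' = mat 1 \<and> B' ** A = mat 1\<close> by (simp add: matrix_mul_assoc)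
  finally show "B' = B" .
qed (use assms in simp)

lemma gaussian_density_corr:
  assumes t: "t > 0" and \<rho>: "\<bar>\<rho>\<bar> < 1"
  shows "gaussian_density (t *\<^sub>R corr_matrix \<rho>) (vector [x, y]) =
    exp (- ((x\<^sup>2 - 2 * \<rho> * x * y + y\<^sup>2) / (2 * t * (1 - \<rho>\<^sup>2)))) / sqrt ((2 * pi)\<^sup>2 * (t\<^sup>2 * (1 - \<rho>\<^sup>2)))"
proof -
  define d where "d = t * (1 - \<rho>\<^sup>2)"
  have "\<rho>\<^sup>2 < 1" using \<rho> by (simp add: abs_square_less_1)
  with t have d: "d > 0" by (simp add: d_def)
  \<comment> \<open>The adjugate formula: the inverse of the correlation matrix has entries 1 and
    -\<rho> over 1 - \<rho>^2, and the time factor t is absorbed into d.\<close>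
  let ?R = "vector [vector [1 / d, - \<rho> / d], vector [- \<rho> / d, 1 / d]] :: real^2^2"
  \<comment> \<open>The diagonal entries of the product with \<open>?R\<close> equal 1 exactly by
    this identity, once denominators are cleared.\<close>
  have e: "t * \<rho> * \<rho> + d = t" by (simp add: d_def power2_eq_square algebra_simps)
  have "matrix_inv (t *\<^sub>R corr_matrix \<rho>) = ?R"
    by (rule matrix_inv_eqI)
       (use d e in \<open>simp_all add: matrix_matrix_mult_def vec_eq_iff forall_2 sum_2 corr_matrix_def mat_def field_simps\<close>)
  moreover have "vector [x, y] \<bullet> (?R *v vector [x, y]) = (x\<^sup>2 - 2 * \<rho> * x * y + y\<^sup>2) / d"
    using d by (simp add: inner_vec_def sum_2 matrix_vector_mult_def field_simps power2_eq_square)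
  moreover have "det (t *\<^sub>R corr_matrix \<rho>) = t\<^sup>2 * (1 - \<rho>\<^sup>2)"
    by (simp add: det_2 corr_matrix_def power2_eq_square algebra_simps)
  moreover have "- (q / d) / 2 = - (q / (2 * t * (1 - \<rho>\<^sup>2)))" for q
    by (simp add: d_def)
  ultimately show ?thesis
    by (simp only: gaussian_density_def) simp
qed

lemma integrable_exp_quadratic:
  fixes \<alpha> \<delta> :: real
  assumes "\<delta> > 0"
  shows "integrable lborel (\<lambda>x. exp (\<alpha> * x - \<delta> * x\<^sup>2))"
proof -
  \<comment> \<open>Mean and standard deviation found by completing the square; the integrand is a
    constant multiple of this normal density.\<close>
  define \<mu> \<sigma> where "\<mu> = \<alpha> / (2 * \<delta>)" and "\<sigma> = 1 / sqrt (2 * \<delta>)"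
  have \<sigma>: "\<sigma>\<^sup>2 = 1 / (2 * \<delta>)" "0 < \<sigma>" using assms by (auto simp: \<sigma>_def power_divide)
  have "exp (\<alpha> * x - \<delta> * x\<^sup>2) = exp (\<delta> * \<mu>\<^sup>2) * sqrt (2 * pi * \<sigma>\<^sup>2) * normal_density \<mu> \<sigma> x" for x
  proof -
    have "\<alpha> * x - \<delta> * x\<^sup>2 = \<delta> * \<mu>\<^sup>2 + - (x - \<mu>)\<^sup>2 / (2 * \<sigma>\<^sup>2)"
      using assms unfolding \<sigma> \<mu>_def by (simp add: field_simps power2_eq_square)
    then show ?thesis
      using \<sigma>(2) by (simp add: normal_density_def flip: exp_add)
  qed
  then show ?thesis using \<sigma>(2) by simp
qed

text \<open>The form has eigenvalues 1 + \<rho> and 1 - \<rho>, the smaller being 1 - |\<rho>|. The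
  bound removes the mixed term, so that the Gaussian density is dominated by a product of functions
  of one variable.\<close>

lemma quadratic_form_lower_bound:
  fixes \<rho> x y :: real
  shows "(1 - \<bar>\<rho>\<bar>) * (x\<^sup>2 + y\<^sup>2) \<le> x\<^sup>2 - 2 * \<rho> * x * y + y\<^sup>2"
proof -
  have "2 * \<bar>x * y\<bar> \<le> x\<^sup>2 + y\<^sup>2"
    using sum_squares_bound[of "\<bar>x\<bar>" "\<bar>y\<bar>"] by (simp add: abs_mult)
  then have "\<bar>\<rho>\<bar> * (2 * \<bar>x * y\<bar>) \<le> \<bar>\<rho>\<bar> * (x\<^sup>2 + y\<^sup>2)"
    by (intro mult_left_mono) auto
  moreover have "2 * \<rho> * x * y \<le> \<bar>\<rho>\<bar> * (2 * \<bar>x * y\<bar>)"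
    using abs_ge_self[of "2 * \<rho> * x * y"] by (simp add: abs_mult mult_ac)
  ultimately show ?thesis by (simp add: algebra_simps)
qed

lemma integrable_gaussian_density_exp:
  assumes t: "t > 0" and \<rho>: "\<bar>\<rho>\<bar> < 1"
  shows "integrable lborel
    (\<lambda>(x, y). gaussian_density (t *\<^sub>R corr_matrix \<rho>) (vector [x, y]) * exp (\<alpha> * x + \<beta> * y))"
proof -
  have r: "\<rho>\<^sup>2 < 1" using \<rho> by (simp add: abs_square_less_1)
  \<comment> \<open>The eigenvalue bound divided by the denominator of the Gaussian
    exponent.\<close>
  define \<delta> where "\<delta> = (1 - \<bar>\<rho>\<bar>) / (2 * t * (1 - \<rho>\<^sup>2))"
  define C where "C = 1 / sqrt ((2 * pi)\<^sup>2 * (t\<^sup>2 * (1 - \<rho>\<^sup>2)))"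
  have \<delta>: "\<delta> > 0" using assms r by (simp add: \<delta>_def)
  have C: "C \<ge> 0" using r by (simp add: C_def)
  let ?f = "\<lambda>x y. gaussian_density (t *\<^sub>R corr_matrix \<rho>) (vector [x, y])"
  have f: "?f x y = C * exp (- ((x\<^sup>2 - 2 * \<rho> * x * y + y\<^sup>2) / (2 * t * (1 - \<rho>\<^sup>2))))" for x y
    by (simp add: gaussian_density_corr[OF assms] C_def)
  let ?e = "\<lambda>\<alpha> x :: real. exp (\<alpha> * x - \<delta> * x\<^sup>2)"
  have "integrable (lborel \<Otimes>\<^sub>M lborel) (\<lambda>(x, y). C * (?e \<alpha> x * ?e \<beta> y))"
    using integrable_exp_quadratic[OF \<delta>, of \<alpha>] integrable_exp_quadratic[OF \<delta>, of \<beta>]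
    by (intro lborel_pair.Fubini_integrable) (auto simp: abs_mult)
  then have "integrable lborel (\<lambda>(x, y). C * (?e \<alpha> x * ?e \<beta> y))"
    by (simp add: lborel_prod)
  then show ?thesis
  proof (rule Bochner_Integration.integrable_bound)
    have "(\<lambda>(x, y). ?f x y * exp (\<alpha> * x + \<beta> * y)) \<in> borel_measurable (borel \<Otimes>\<^sub>M borel)"
      unfolding f by measurable
    then show "(\<lambda>(x, y). ?f x y * exp (\<alpha> * x + \<beta> * y)) \<in> borel_measurable lborel"
      by (simp add: borel_prod)
    have "norm (?f x y * exp (\<alpha> * x + \<beta> * y)) \<le> norm (C * (?e \<alpha> x * ?e \<beta> y))" for x y
    proof -
      have "\<delta> * x\<^sup>2 + \<delta> * y\<^sup>2 \<le> (x\<^sup>2 - 2 * \<rho> * x * y + y\<^sup>2) / (2 * t * (1 - \<rho>\<^sup>2))"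
        using divide_right_mono[OF quadratic_form_lower_bound[of \<rho> x y], of "2 * t * (1 - \<rho>\<^sup>2)"] t r
        by (simp add: \<delta>_def distrib_left add_divide_distrib)
      then have "?f x y * exp (\<alpha> * x + \<beta> * y) \<le> C * (?e \<alpha> x * ?e \<beta> y)"
        unfolding f mult.assoc exp_add[symmetric] by (intro mult_left_mono C) simp
      moreover have "0 \<le> ?f x y" using C by (simp add: f)
      ultimately show ?thesis using C by (simp add: abs_mult)
    qed
    then show "AE p in lborel. norm (case p of (x, y) \<Rightarrow> ?f x y * exp (\<alpha> * x + \<beta> * y))
        \<le> norm (case p of (x, y) \<Rightarrow> C * (?e \<alpha> x * ?e \<beta> y))"
      by auto
  qed
qed

locale exp_ac_pair = ac_pair +
  assumes exp_int: "\<And>\<alpha> \<beta>. integrable M (\<lambda>\<omega>. exp (\<alpha> * U \<omega> + \<beta> * V \<omega>))"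

text \<open>A Wiener process is specified through its increments, so the law at time T is read off
  the increment over [0, T] together with the almost sure start at 0.\<close>

lemma wiener_process_exp_ac_pair:
  assumes T: "T > 0" and Q: "pos_def (corr_matrix \<rho>)"
    and W: "wiener_process_2d P (corr_matrix \<rho>) T W1 W2"
  shows "exp_ac_pair P (W1 T) (W2 T)"
proof -
  interpret prob_space P using W by (simp add: wiener_process_2d_def)
  have meas[measurable]: "W1 T \<in> borel_measurable P" "W2 T \<in> borel_measurable P"
      "W1 0 \<in> borel_measurable P" "W2 0 \<in> borel_measurable P"
    using W T by (auto simp: wiener_process_2d_def)
  have start: "AE \<omega> in P. W1 0 \<omega> = 0 \<and> W2 0 \<omega> = 0"
    using W by (simp add: wiener_process_2d_def)
  define f where "f = (\<lambda>(x, y). gaussian_density (T *\<^sub>R corr_matrix \<rho>) (vector [x, y]))"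
  let ?X = "\<lambda>\<omega>. (W1 T \<omega> - W1 0 \<omega>, W2 T \<omega> - W2 0 \<omega>)"
  have "\<forall>s t. 0 \<le> s \<and> s < t \<and> t \<le> T \<longrightarrow>
        distributed P lborel (\<lambda>\<omega>. (W1 t \<omega> - W1 s \<omega>, W2 t \<omega> - W2 s \<omega>))
          (\<lambda>(x, y). ennreal (gaussian_density ((t - s) *\<^sub>R corr_matrix \<rho>) (vector [x, y])))"
    using W unfolding wiener_process_2d_def by blast
  from this[rule_format, of 0 T] have X: "distributed P lborel ?X (\<lambda>p. ennreal (f p))"
    using T by (simp add: f_def case_prod_unfold)
  have \<rho>: "\<bar>\<rho>\<bar> < 1" by (rule abs_corr_less_1[OF Q])
  have r: "\<rho>\<^sup>2 < 1" using \<rho> by (simp add: abs_square_less_1)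
  have f_nonneg: "0 \<le> f p" for p
    using r by (cases p) (simp add: f_def gaussian_density_corr[OF T \<rho>])
  show ?thesis
  proof
    fix N :: "(real \<times> real) set" assume N: "N \<in> null_sets lborel"
    have "AE p in distr P lborel ?X. p \<notin> N"
      unfolding distributed_distr_eq_density[OF X]
      using AE_not_in[OF N] distributed_borel_measurable[OF X]
      by (subst AE_density) (auto elim!: eventually_mono)
    then have "AE \<omega> in P. ?X \<omega> \<notin> N"
      by (rule AE_distrD[rotated]) measurable
    with start show "AE \<omega> in P. (W1 T \<omega>, W2 T \<omega>) \<notin> N"
      by eventually_elim simp
  next
    fix \<alpha> \<beta> :: real
    have "integrable lborel (\<lambda>p. f p * exp (\<alpha> * fst p + \<beta> * snd p))"
      using integrable_gaussian_density_exp[OF T \<rho>, of \<alpha> \<beta>] by (simp add: f_def case_prod_unfold)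
    moreover have "(\<lambda>p :: real \<times> real. exp (\<alpha> * fst p + \<beta> * snd p)) \<in> borel_measurable lborel"
      unfolding measurable_lborel2 borel_prod[symmetric] by measurable
    ultimately have "integrable P (\<lambda>\<omega>. exp (\<alpha> * fst (?X \<omega>) + \<beta> * snd (?X \<omega>)))"
      using distributed_integrable[OF X, of "\<lambda>p. exp (\<alpha> * fst p + \<beta> * snd p)"] f_nonneg by simp
    moreover have "AE \<omega> in P. exp (\<alpha> * fst (?X \<omega>) + \<beta> * snd (?X \<omega>)) = exp (\<alpha> * W1 T \<omega> + \<beta> * W2 T \<omega>)"
      using start by eventually_elim simp
    ultimately show "integrable P (\<lambda>\<omega>. exp (\<alpha> * W1 T \<omega> + \<beta> * W2 T \<omega>))"
      by (subst (asm) integrable_cong_AE) auto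
  qed auto
qed

lemma (in exp_ac_pair) exp_ac_pair_swap: "exp_ac_pair M V U"
proof -
  interpret swap: ac_pair M V U by (rule ac_pair_swap)
  show ?thesis
    by unfold_locales (subst add.commute, rule exp_int)
qed

text \<open>A product of exponentials of linear forms is again one: moments under the new measure
  are moments under the old one with exponents \<kappa> + \<alpha> and \<eta> + \<beta>, up to a
  constant produced by d and the shifts.\<close>

lemma (in exp_ac_pair) exp_ac_pair_translate_density:
  "exp_ac_pair (density M (\<lambda>\<omega>. ennreal (exp (\<kappa> * U \<omega> + \<eta> * V \<omega> + d))))
     (\<lambda>\<omega>. U \<omega> + s) (\<lambda>\<omega>. V \<omega> + t)"
proof -
  let ?Z = "\<lambda>\<omega>. exp (\<kappa> * U \<omega> + \<eta> * V \<omega> + d)"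
  have Z: "integrable M ?Z"
    using integrable_mult_right[OF exp_int[of \<kappa> \<eta>], of "exp d"] by (simp add: exp_add mult.commute)
  have "finite_measure (density M (\<lambda>\<omega>. ennreal (?Z \<omega>)))"
    using nn_integral_eq_integral[OF Z] by (intro finite_measureI) (simp add: emeasure_density)
  then interpret D: ac_pair "density M (\<lambda>\<omega>. ennreal (?Z \<omega>))" "\<lambda>\<omega>. U \<omega> + s" "\<lambda>\<omega>. V \<omega> + t"
    by (intro ac_pair_translate_density) auto
  show ?thesis
  proof
    fix \<alpha> \<beta>
    have "integrable M (\<lambda>\<omega>. exp (d + \<alpha> * s + \<beta> * t) * exp ((\<kappa> + \<alpha>) * U \<omega> + (\<eta> + \<beta>) * V \<omega>))"
      by (intro integrable_mult_right exp_int)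
    then have "integrable M (\<lambda>\<omega>. ?Z \<omega> *\<^sub>R exp (\<alpha> * (U \<omega> + s) + \<beta> * (V \<omega> + t)))"
      by (simp flip: exp_add) (simp add: algebra_simps)
    then show "integrable (density M (\<lambda>\<omega>. ennreal (?Z \<omega>))) (\<lambda>\<omega>. exp (\<alpha> * (U \<omega> + s) + \<beta> * (V \<omega> + t)))"
      by (subst integrable_density) auto
  qed
qed

section \<open>The pay-off\<close>

lemma strike_less_bs_price_iff:
  assumes "s > 0" "\<sigma> > 0" "K > 0"
  shows "K < bs_price s \<mu> \<sigma> T x \<longleftrightarrow> 1 / \<sigma> * (ln (K / s) - (\<mu> - \<sigma>\<^sup>2 / 2) * T) < x"
proof -
  have "K < bs_price s \<mu> \<sigma> T x \<longleftrightarrow> K / s < exp ((\<mu> - \<sigma>\<^sup>2 / 2) * T + \<sigma> * x)"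
    using assms by (simp add: bs_price_def field_simps)
  also have "\<dots> \<longleftrightarrow> ln (K / s) < (\<mu> - \<sigma>\<^sup>2 / 2) * T + \<sigma> * x"
    using assms by (subst ln_less_cancel_iff[symmetric]) auto
  also have "\<dots> \<longleftrightarrow> 1 / \<sigma> * (ln (K / s) - (\<mu> - \<sigma>\<^sup>2 / 2) * T) < x"
    using assms by (auto simp: field_simps)
  finally show ?thesis .
qed

lemma bs_price_less_iff:
  assumes "s1 > 0" "s2 > 0"
  shows "bs_price s2 \<mu>2 \<sigma>2 T y < bs_price s1 \<mu>1 \<sigma>1 T x \<longleftrightarrow>
    ln (s2 / s1) + (\<mu>2 - \<mu>1 - (\<sigma>2\<^sup>2 - \<sigma>1\<^sup>2) / 2) * T < \<sigma>1 * x - \<sigma>2 * y"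
proof -
  have "bs_price s2 \<mu>2 \<sigma>2 T y < bs_price s1 \<mu>1 \<sigma>1 T x \<longleftrightarrow>
      ln (bs_price s2 \<mu>2 \<sigma>2 T y) < ln (bs_price s1 \<mu>1 \<sigma>1 T x)"
    using assms by (subst ln_less_cancel_iff) (auto simp: bs_price_def)
  also have "\<dots> \<longleftrightarrow> ln s2 + (\<mu>2 - \<sigma>2\<^sup>2 / 2) * T + \<sigma>2 * y < ln s1 + (\<mu>1 - \<sigma>1\<^sup>2 / 2) * T + \<sigma>1 * x"
    using assms by (simp add: bs_price_def ln_mult add.assoc)
  also have "\<dots> \<longleftrightarrow> ln (s2 / s1) + (\<mu>2 - \<mu>1 - (\<sigma>2\<^sup>2 - \<sigma>1\<^sup>2) / 2) * T < \<sigma>1 * x - \<sigma>2 * y"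
    using assms by (simp add: ln_div algebra_simps add_divide_distrib diff_divide_distrib)
  finally show ?thesis .
qed

lemma borel_measurable_bs_price [measurable]: "bs_price s \<mu> \<sigma> T \<in> borel_measurable borel"
  unfolding bs_price_def by measurable

text \<open>\<open>F 0 = 0\<close> disposes of the case where the option expires worthless. The
  excluded value of y is the tie of the two prices, where both strict indicators vanish although the
  pay-off may be positive. A general F serves the linear loss as well as both power-loss
  integrands.\<close>

lemma outperformance_payoff_split:
  fixes F :: "real \<Rightarrow> real"
  assumes s: "s1 > 0" "s2 > 0" and \<sigma>: "\<sigma>1 > 0" "\<sigma>2 > 0" and K: "K > 0" and F: "F 0 = 0"
    and a: "a1 = 1 / \<sigma>1 * (ln (K / s1) - (\<mu>1 - \<sigma>1\<^sup>2 / 2) * T)"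
           "a2 = 1 / \<sigma>2 * (ln (K / s2) - (\<mu>2 - \<sigma>2\<^sup>2 / 2) * T)"
    and b: "b = ln (s2 / s1) + (\<mu>2 - \<mu>1 - (\<sigma>2\<^sup>2 - \<sigma>1\<^sup>2) / 2) * T"
    and ne: "y \<noteq> (\<sigma>1 * x - b) / \<sigma>2"
  shows "F (max (max (bs_price s1 \<mu>1 \<sigma>1 T x) (bs_price s2 \<mu>2 \<sigma>2 T y) - K) 0) =
      of_bool (a1 < x \<and> y < (\<sigma>1 * x - b) / \<sigma>2) * F (bs_price s1 \<mu>1 \<sigma>1 T x - K)
    + of_bool (a2 < y \<and> x < (\<sigma>2 * y + b) / \<sigma>1) * F (bs_price s2 \<mu>2 \<sigma>2 T y - K)"
proof -
  let ?p1 = "bs_price s1 \<mu>1 \<sigma>1 T x" and ?p2 = "bs_price s2 \<mu>2 \<sigma>2 T y"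
  have 1: "K < ?p1 \<longleftrightarrow> a1 < x" "K < ?p2 \<longleftrightarrow> a2 < y"
    unfolding a using s \<sigma> K by (auto simp: strike_less_bs_price_iff)
  have 2: "?p2 < ?p1 \<longleftrightarrow> y < (\<sigma>1 * x - b) / \<sigma>2"
    using \<sigma> unfolding bs_price_less_iff[OF s] b[symmetric] by (auto simp: field_simps)
  have 3: "\<not> y < (\<sigma>1 * x - b) / \<sigma>2 \<longleftrightarrow> x < (\<sigma>2 * y + b) / \<sigma>1"
    using ne \<sigma> by (auto simp: field_simps not_less)
  show ?thesis
    unfolding 1[symmetric] 3[symmetric] 2[symmetric]
    using F by (auto simp: max_def)
qed

section \<open>The boundary curves\<close>

lemma borel_measurable_eln [measurable]: "eln \<in> borel_measurable borel"
  unfolding eln_def by measurable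

lemma borel_measurable_boundary [measurable]:
  assumes [measurable]: "g \<in> borel_measurable borel"
  shows "boundary A A' B T p c g \<in> borel_measurable borel"
  unfolding boundary_def by measurable

text \<open>Solving (cZ)^(1/(p-1)) = g for y gives the curve. Since A' > 0, Z decreases in y, so
  points below the curve are those where the pay-off is the smaller of the two.\<close>

lemma
  assumes A': "A' > 0" and p: "p > 1" and c: "c \<ge> 0" and g: "g x > 0"
  shows less_boundary_iff: "ereal y < boundary A A' B T p c g x \<longleftrightarrow>
      g x < (c * exp (- A * x - A' * y - B * T)) powr (1 / (p - 1))" (is ?less)
    and boundary_less_iff: "boundary A A' B T p c g x < ereal y \<longleftrightarrow>
      (c * exp (- A * x - A' * y - B * T)) powr (1 / (p - 1)) < g x" (is ?greater)
proof -
  have pos: "g x powr (p - 1) > 0" using g by simp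
  consider "c = 0" | "c > 0" using c by linarith
  then have "?less \<and> ?greater"
  proof cases
    case 1
    \<comment> \<open>For c = 0 the reciprocal is \<infinity> in \<open>ereal\<close>, so the curve
      lies at -\<infinity> and every real y is above it; this agrees with 0 < g on the other
      side.\<close>
    have "boundary A A' B T p c g x = - \<infinity>"
    proof -
      have "1 / ereal c = \<infinity>" using 1 by (simp add: divide_ereal_def zero_ereal_def[symmetric])
      then show ?thesis using pos A' unfolding boundary_def eln_def by simp
    qed
    then show ?thesis using 1 g by simp
  next
    case 2
    let ?l = "(p - 1) * ln (g x) - ln c" and ?Y = "(c * exp (- A * x - A' * y - B * T)) powr (1 / (p - 1))"
    have "boundary A A' B T p c g x = ereal (- (1 / A') * (A * x + B * T + ?l))"
      using 2 g by (simp add: boundary_def eln_def one_ereal_def ln_mult ln_powr ln_div not_le)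
    moreover have "ln ?Y = (ln c - A * x - A' * y - B * T) / (p - 1)"
      using 2 by (simp add: ln_powr ln_mult)
    moreover have "g x < ?Y \<longleftrightarrow> ln (g x) < ln ?Y" "?Y < g x \<longleftrightarrow> ln ?Y < ln (g x)"
      using 2 g by (subst ln_less_cancel_iff; simp)+
    moreover have "y < - (1 / A') * (A * x + B * T + ?l) \<longleftrightarrow> ln (g x) < (ln c - A * x - A' * y - B * T) / (p - 1)"
      "- (1 / A') * (A * x + B * T + ?l) < y \<longleftrightarrow> (ln c - A * x - A' * y - B * T) / (p - 1) < ln (g x)"
      using A' p by (simp_all add: field_simps)
    ultimately show ?thesis by (simp only: less_ereal.simps)
  qed
  then show ?less ?greater by auto
qed

text \<open>For c = 0 both sides are true, the right one because \<open>eln 0\<close> is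
  -\<infinity>; the real logarithm with \<open>ln 0 = 0\<close> would fail here.\<close>

lemma le_exp_iff_eln:
  assumes "c \<ge> 0"
  shows "c \<le> exp (u + d) \<longleftrightarrow> eln (ereal c) - ereal d \<le> ereal u"
proof (cases "c = 0")
  case False
  with assms have "c \<le> exp (u + d) \<longleftrightarrow> ln c \<le> u + d"
    by (subst ln_le_cancel_iff[symmetric]) auto
  then show ?thesis using assms False by (auto simp: eln_def)
qed (simp add: eln_def)

lemma powr_exponential_form:
  fixes c q w :: real
  assumes "c \<ge> 0"
  shows "((c * exp w) powr (1 / r)) powr q = c powr (q / r) * exp (q * w / r)"
  using assms by (simp add: powr_powr powr_mult exp_powr_real)

section \<open>Integrability and power loss on the event that one given asset is the larger\<close>

context exp_ac_pair
begin

lemma integrable_exp_bound: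
  assumes [measurable]: "F \<in> borel_measurable M"
    and "\<And>\<omega>. \<bar>F \<omega>\<bar> \<le> C * exp (\<alpha> * U \<omega> + \<beta> * V \<omega>)"
  shows "integrable M (F :: 'a \<Rightarrow> real)"
proof (rule Bochner_Integration.integrable_bound)
  show "integrable M (\<lambda>\<omega>. C * exp (\<alpha> * U \<omega> + \<beta> * V \<omega>))"
    by (intro integrable_mult_right exp_int)
  show "AE \<omega> in M. norm (F \<omega>) \<le> norm (C * exp (\<alpha> * U \<omega> + \<beta> * V \<omega>))"
    using assms(2) by (auto intro: order.trans[OF _ abs_ge_self])
qed fact

lemma integrable_exp_region:
  assumes [measurable]: "Measurable.pred (borel \<Otimes>\<^sub>M borel) (\<lambda>(x, y). R x y)"
  shows "integrable M (\<lambda>\<omega>. of_bool (R (U \<omega>) (V \<omega>)) * exp (\<alpha> * U \<omega> + \<beta> * V \<omega>))"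
  by (rule integrable_exp_bound[where C=1 and \<alpha>=\<alpha> and \<beta>=\<beta>]) (auto intro: measurable_If)

text \<open>Here g is the pay-off of one asset as a function of its own driving variable and a the
  exercise threshold. Positivity beyond a and exponential growth are all that is assumed of g, so
  either asset can take this role.\<close>

context
  fixes g :: "real \<Rightarrow> real" and a s \<sigma> :: real
  assumes g [measurable]: "g \<in> borel_measurable borel"
    and g_pos_all: "\<forall>x>a. 0 < g x" and g_le: "\<And>x. g x \<le> s * exp (\<sigma> * x)"
begin

lemmas g_pos = g_pos_all[rule_format]

lemma payoff_constant_nonneg: "0 \<le> s"
  using g_pos[of "a + 1"] g_le[of "a + 1"] by (simp add: zero_less_mult_iff order_less_le_trans less_imp_le)
    (metis exp_gt_zero mult_nonpos_nonneg not_less order_less_le_trans less_imp_le)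

text \<open>Beyond the threshold g is positive, so its power inherits the exponential bound. The
  exponent is p for the shortfall and 1 for the bare pay-off.\<close>

lemma integrable_power_payoff:
  assumes [measurable]: "Measurable.pred (borel \<Otimes>\<^sub>M borel) (\<lambda>(x, y). R x y)" and q: "0 \<le> q"
  shows "integrable M (\<lambda>\<omega>. of_bool (a < U \<omega> \<and> R (U \<omega>) (V \<omega>)) * g (U \<omega>) powr q)"
proof (rule integrable_exp_bound)
  fix \<omega>
  show "\<bar>of_bool (a < U \<omega> \<and> R (U \<omega>) (V \<omega>)) * g (U \<omega>) powr q\<bar> \<le> s powr q * exp ((q * \<sigma>) * U \<omega> + 0 * V \<omega>)"
    using powr_mono2[OF q _ g_le, of "U \<omega>"] g_pos[of "U \<omega>"] payoff_constant_nonneg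
    by (auto simp: powr_mult exp_powr_real mult_ac)
qed measurable

context
  fixes A A' B T p c :: real and k :: "real \<Rightarrow> real"
  assumes A': "A' > 0" and p: "p > 1" and c: "c \<ge> 0" and k [measurable]: "k \<in> borel_measurable borel"
begin

text \<open>The curve may take infinite values, but a real number can only meet it at a finite one,
  so the graph of its \<open>real_of_ereal\<close> suffices.\<close>

lemma AE_neq_boundary: "AE \<omega> in M. ereal (V \<omega>) \<noteq> boundary A A' B T p c g (U \<omega>)"
proof -
  let ?v = "boundary A A' B T p c g"
  have "AE \<omega> in M. V \<omega> \<noteq> real_of_ereal (?v (U \<omega>))"
    using AE_neq_graph[of "\<lambda>x. real_of_ereal (?v x)"] by simp
  then show ?thesis
    by eventually_elim (metis real_of_ereal.simps(1))
qed

text \<open>Below the curve the minimum is g, above it (cZ)^(1/(p-1)), whose p-th power is again an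
  exponential of a linear form. Both inner intervals are open, so points on the curve are lost and
  the decomposition holds only almost surely. Where the curve lies above k the second interval is
  empty and the first is cut off at k.\<close>

lemma power_shortfall_half:
  defines "F \<equiv> \<lambda>\<omega>. of_bool (a < U \<omega> \<and> V \<omega> < k (U \<omega>)) * min (g (U \<omega>)) (((c * exp (- A * U \<omega> - A' * V \<omega> - B * T)) powr (1 / (p - 1)))) powr p"
  shows "integrable M F"
    and "1 / p * (LBINT x:{a<..}. (LBINT y:einterval (-\<infinity>) (min (boundary A A' B T p c g x) (ereal (k x))).
             g x powr p * cond_density M V U x y) * rv_density M U x)
       + 1 / p * c powr (p / (p - 1)) * exp (- (p * B * T / (p - 1))) *
         (LBINT x:{a<..}. (LBINT y:einterval (boundary A A' B T p c g x) (ereal (k x)).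
             exp (- (p * A / (p - 1)) * x - p * A' / (p - 1) * y) * cond_density M V U x y) * rv_density M U x)
       = 1 / p * (\<integral>\<omega>. F \<omega> \<partial>M)"
proof -
  let ?v = "boundary A A' B T p c g"
  let ?Y = "\<lambda>x y. (c * exp (- A * x - A' * y - B * T)) powr (1 / (p - 1))"
  let ?E1 = "\<lambda>x. einterval (-\<infinity>) (min (?v x) (ereal (k x)))" and ?E2 = "\<lambda>x. einterval (?v x) (ereal (k x))"
  let ?e = "\<lambda>x y. exp (- (p * A / (p - 1)) * x - p * A' / (p - 1) * y)"
  let ?C = "c powr (p / (p - 1)) * exp (- (p * B * T / (p - 1)))"
  let ?F1 = "\<lambda>\<omega>. of_bool (U \<omega> \<in> {a<..} \<and> V \<omega> \<in> ?E1 (U \<omega>)) * g (U \<omega>) powr p"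
  let ?F2 = "\<lambda>\<omega>. of_bool (U \<omega> \<in> {a<..} \<and> V \<omega> \<in> ?E2 (U \<omega>)) * ?e (U \<omega>) (V \<omega>)"
  have [measurable]: "Measurable.pred (borel \<Otimes>\<^sub>M borel) (\<lambda>(x, y). y \<in> ?E1 x)"
      "Measurable.pred (borel \<Otimes>\<^sub>M borel) (\<lambda>(x, y). y \<in> ?E2 x)"
    unfolding einterval_def mem_Collect_eq by measurable
  have i1: "integrable M ?F1"
    using integrable_power_payoff[of "\<lambda>x y. y \<in> ?E1 x" p] p by simp
  have i2: "integrable M ?F2"
    using integrable_exp_region[of "\<lambda>x y. x \<in> {a<..} \<and> y \<in> ?E2 x" "- (p * A / (p - 1))" "- (p * A' / (p - 1))"]
    by simp
  have Fm: "F \<in> borel_measurable M" unfolding F_def by measurable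
  have Y: "?Y x y powr p = ?C * ?e x y" for x y
    using c p by (simp add: powr_exponential_form exp_add[symmetric] mult.assoc) (simp add: diff_divide_distrib add_divide_distrib algebra_simps)
  have F: "AE \<omega> in M. F \<omega> = ?F1 \<omega> + ?C * ?F2 \<omega>"
    using AE_neq_boundary
  proof eventually_elim
    case (elim \<omega>)
    show ?case
    proof (cases "a < U \<omega> \<and> V \<omega> < k (U \<omega>)")
      case True
      note iffs = less_boundary_iff[where g=g, OF A' p c g_pos, of "U \<omega>" "V \<omega>" A B T]
        boundary_less_iff[where g=g, OF A' p c g_pos, of "U \<omega>" A B T "V \<omega>"]
      show ?thesis
      proof (cases "ereal (V \<omega>) < ?v (U \<omega>)")
        case less: True
        then have "g (U \<omega>) < ?Y (U \<omega>) (V \<omega>)" using iffs True by simp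
        with True less show ?thesis by (auto simp: F_def einterval_def min_def)
      next
        case False
        with elim have "?v (U \<omega>) < ereal (V \<omega>)" by auto
        moreover from this have "?Y (U \<omega>) (V \<omega>) < g (U \<omega>)" using iffs True by simp
        \<comment> \<open>This evaluates the minimum in \<open>?E1\<close> to the curve, which shows
          that V lies outside \<open>?E1\<close>.\<close>
        moreover have "?v (U \<omega>) \<le> ereal (k (U \<omega>))"
          using True \<open>?v (U \<omega>) < ereal (V \<omega>)\<close> by (meson less_ereal.simps(1) less_imp_le less_trans)
        ultimately show ?thesis using True Y by (auto simp: F_def einterval_def min_def)
      qed
    qed (auto simp: F_def einterval_def)
  qed
  have i: "integrable M (\<lambda>\<omega>. ?F1 \<omega> + ?C * ?F2 \<omega>)"
    using i1 i2 by (intro Bochner_Integration.integrable_add integrable_mult_right)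
  then show "integrable M F"
    using integrable_cong_AE[OF Fm borel_measurable_integrable[OF i] F] by simp
  have "(\<integral>\<omega>. F \<omega> \<partial>M) = (\<integral>\<omega>. ?F1 \<omega> + ?C * ?F2 \<omega> \<partial>M)"
    by (rule integral_cong_AE[OF Fm borel_measurable_integrable[OF i] F])
  also have "\<dots> = (\<integral>\<omega>. ?F1 \<omega> \<partial>M) + ?C * (\<integral>\<omega>. ?F2 \<omega> \<partial>M)"
    using i1 i2 by (subst Bochner_Integration.integral_add) (auto simp del: mem_Collect_eq)
  also have "(\<integral>\<omega>. ?F1 \<omega> \<partial>M) = (LBINT x:{a<..}. (LBINT y:?E1 x.
             g x powr p * cond_density M V U x y) * rv_density M U x)"
    using i1 by (intro set_integral_cond_density[symmetric]) measurable
  also have "(\<integral>\<omega>. ?F2 \<omega> \<partial>M) = (LBINT x:{a<..}. (LBINT y:?E2 x.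
             ?e x y * cond_density M V U x y) * rv_density M U x)"
    using i2 by (intro set_integral_cond_density[symmetric]) measurable
  finally show "1 / p * (LBINT x:{a<..}. (LBINT y:?E1 x. g x powr p * cond_density M V U x y) * rv_density M U x)
       + 1 / p * c powr (p / (p - 1)) * exp (- (p * B * T / (p - 1))) *
         (LBINT x:{a<..}. (LBINT y:?E2 x. ?e x y * cond_density M V U x y) * rv_density M U x)
       = 1 / p * (\<integral>\<omega>. F \<omega> \<partial>M)"
    by (simp add: distrib_left mult.assoc)
qed

text \<open>The positive part vanishes on and below the curve, so one region is enough. As it is 0
  on the curve itself, the decomposition holds at every point, in contrast to the shortfall.\<close>

lemma power_hedge_half:
  defines "F \<equiv> \<lambda>\<omega>. of_bool (a < U \<omega> \<and> V \<omega> < k (U \<omega>)) * max (g (U \<omega>) - ((c * exp (- A * U \<omega> - A' * V \<omega> - B * T)) powr (1 / (p - 1)))) 0"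
  shows "integrable M F"
    and "(LBINT x:{a<..}. (LBINT y:einterval (boundary A A' B T p c g x) (ereal (k x)).
             g x * cond_density M V U x y) * rv_density M U x)
       - c powr (1 / (p - 1)) * exp (- (B / (p - 1) * T)) *
         (LBINT x:{a<..}. (LBINT y:einterval (boundary A A' B T p c g x) (ereal (k x)).
             exp (- (A / (p - 1)) * x - A' / (p - 1) * y) * cond_density M V U x y) * rv_density M U x)
       = (\<integral>\<omega>. F \<omega> \<partial>M)"
proof -
  let ?v = "boundary A A' B T p c g"
  let ?Y = "\<lambda>x y. (c * exp (- A * x - A' * y - B * T)) powr (1 / (p - 1))"
  let ?E = "\<lambda>x. einterval (?v x) (ereal (k x))"
  let ?e = "\<lambda>x y. exp (- (A / (p - 1)) * x - A' / (p - 1) * y)"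
  let ?C = "c powr (1 / (p - 1)) * exp (- (B / (p - 1) * T))"
  let ?F1 = "\<lambda>\<omega>. of_bool (U \<omega> \<in> {a<..} \<and> V \<omega> \<in> ?E (U \<omega>)) * g (U \<omega>)"
  let ?F2 = "\<lambda>\<omega>. of_bool (U \<omega> \<in> {a<..} \<and> V \<omega> \<in> ?E (U \<omega>)) * ?e (U \<omega>) (V \<omega>)"
  have [measurable]: "Measurable.pred (borel \<Otimes>\<^sub>M borel) (\<lambda>(x, y). y \<in> ?E x)"
    unfolding einterval_def mem_Collect_eq by measurable
  have "?F1 = (\<lambda>\<omega>. of_bool (a < U \<omega> \<and> V \<omega> \<in> ?E (U \<omega>)) * g (U \<omega>) powr 1)"
    using g_pos by (auto simp: fun_eq_iff powr_one less_imp_le)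
  then have i1: "integrable M ?F1"
    using integrable_power_payoff[of "\<lambda>x y. y \<in> ?E x" 1] by simp
  have i2: "integrable M ?F2"
    using integrable_exp_region[of "\<lambda>x y. x \<in> {a<..} \<and> y \<in> ?E x" "- (A / (p - 1))" "- (A' / (p - 1))"]
    by simp
  have Fm: "F \<in> borel_measurable M" unfolding F_def by measurable
  have Y: "?Y x y = ?C * ?e x y" for x y
    using powr_exponential_form[OF c, of "- A * x - A' * y - B * T" "p - 1" 1]
    by (simp add: exp_add[symmetric] mult.assoc) (simp add: diff_divide_distrib add_divide_distrib algebra_simps)
  have F: "F \<omega> = ?F1 \<omega> - ?C * ?F2 \<omega>" for \<omega>
  proof (cases "a < U \<omega> \<and> V \<omega> < k (U \<omega>)")
    case True
    have "?v (U \<omega>) < ereal (V \<omega>) \<longleftrightarrow> ?Y (U \<omega>) (V \<omega>) < g (U \<omega>)"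
      using boundary_less_iff[where g=g, OF A' p c g_pos, of "U \<omega>" A B T "V \<omega>"] True by simp
    then show ?thesis using True Y[of "U \<omega>" "V \<omega>"] by (auto simp: F_def einterval_def max_def)
  qed (auto simp: F_def einterval_def)
  show "integrable M F"
    unfolding F using i1 i2 by (intro Bochner_Integration.integrable_diff integrable_mult_right)
  have "(\<integral>\<omega>. F \<omega> \<partial>M) = (\<integral>\<omega>. ?F1 \<omega> \<partial>M) - ?C * (\<integral>\<omega>. ?F2 \<omega> \<partial>M)"
    unfolding F using i1 i2 by (subst Bochner_Integration.integral_diff) (auto simp del: mem_Collect_eq)
  also have "(\<integral>\<omega>. ?F1 \<omega> \<partial>M) = (LBINT x:{a<..}. (LBINT y:?E x.
             g x * cond_density M V U x y) * rv_density M U x)"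
    using i1 by (intro set_integral_cond_density[symmetric]) measurable
  also have "(\<integral>\<omega>. ?F2 \<omega> \<partial>M) = (LBINT x:{a<..}. (LBINT y:?E x.
             ?e x y * cond_density M V U x y) * rv_density M U x)"
    using i2 by (intro set_integral_cond_density[symmetric]) measurable
  finally show "(LBINT x:{a<..}. (LBINT y:?E x. g x * cond_density M V U x y) * rv_density M U x)
       - c powr (1 / (p - 1)) * exp (- (B / (p - 1) * T)) *
         (LBINT x:{a<..}. (LBINT y:?E x. ?e x y * cond_density M V U x y) * rv_density M U x)
       = (\<integral>\<omega>. F \<omega> \<partial>M)"
    by simp
qed

end

end

end

section \<open>The formulas for one pair of driving variables\<close>

lemma bs_price_diff_le:
  assumes "K > 0"
  shows "bs_price s \<mu> \<sigma> T x - K \<le> s * exp ((\<mu> - \<sigma>\<^sup>2 / 2) * T) * exp (\<sigma> * x)"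
  using assms by (simp add: bs_price_def exp_add mult.assoc)

context exp_ac_pair
begin

text \<open>U and V stand for the driving variables under either measure, and \<mu>1, \<mu>2, B are
  free. The half where the second asset dominates is the one-asset result for the swapped
  pair.\<close>

context
  fixes s1 s2 \<mu>1 \<mu>2 \<sigma>1 \<sigma>2 T K a1 a2 b c A1 A2 B :: real and g1 g2 :: "real \<Rightarrow> real"
    and D H :: "'a \<Rightarrow> real"
  assumes s: "s1 > 0" "s2 > 0" and \<sigma>: "\<sigma>1 > 0" "\<sigma>2 > 0" and K: "K > 0"
    and a: "a1 = 1 / \<sigma>1 * (ln (K / s1) - (\<mu>1 - \<sigma>1\<^sup>2 / 2) * T)"
           "a2 = 1 / \<sigma>2 * (ln (K / s2) - (\<mu>2 - \<sigma>2\<^sup>2 / 2) * T)"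
    and b: "b = ln (s2 / s1) + (\<mu>2 - \<mu>1 - (\<sigma>2\<^sup>2 - \<sigma>1\<^sup>2) / 2) * T"
    and g: "g1 = (\<lambda>x. bs_price s1 \<mu>1 \<sigma>1 T x - K)" "g2 = (\<lambda>x. bs_price s2 \<mu>2 \<sigma>2 T x - K)"
    and D: "D = (\<lambda>\<omega>. \<sigma>1 * U \<omega> - \<sigma>2 * V \<omega>)"
    and H: "H = (\<lambda>\<omega>. max (max (bs_price s1 \<mu>1 \<sigma>1 T (U \<omega>)) (bs_price s2 \<mu>2 \<sigma>2 T (V \<omega>)) - K) 0)"
    and c: "c \<ge> 0"
begin

interpretation swap: exp_ac_pair M V U by (rule exp_ac_pair_swap)

lemma g_measurable [measurable]: "g1 \<in> borel_measurable borel" "g2 \<in> borel_measurable borel"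
  unfolding g by measurable

lemma g_positive: "a1 < x \<Longrightarrow> 0 < g1 x" "a2 < x \<Longrightarrow> 0 < g2 x"
  using strike_less_bs_price_iff[of s1 \<sigma>1 K \<mu>1 T x] strike_less_bs_price_iff[of s2 \<sigma>2 K \<mu>2 T x] s \<sigma> K
  by (auto simp: g a)

lemma g_positive_all: "\<forall>x>a1. 0 < g1 x" "\<forall>x>a2. 0 < g2 x"
  using g_positive by auto

lemma g_exp_bound:
  "g1 x \<le> s1 * exp ((\<mu>1 - \<sigma>1\<^sup>2 / 2) * T) * exp (\<sigma>1 * x)"
  "g2 x \<le> s2 * exp ((\<mu>2 - \<sigma>2\<^sup>2 / 2) * T) * exp (\<sigma>2 * x)"
  unfolding g by (intro bs_price_diff_le K)+

text \<open>F may depend on the outcome, so that it can carry Z or the indicator of the linear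
  loss.\<close>

lemma AE_payoff_split:
  assumes "\<And>\<omega>. F \<omega> 0 = (0 :: real)"
  shows "AE \<omega> in M. F \<omega> (H \<omega>) =
      of_bool (a1 < U \<omega> \<and> V \<omega> < (\<sigma>1 * U \<omega> - b) / \<sigma>2) * F \<omega> (g1 (U \<omega>))
    + of_bool (a2 < V \<omega> \<and> U \<omega> < (\<sigma>2 * V \<omega> + b) / \<sigma>1) * F \<omega> (g2 (V \<omega>))"
proof -
  have "AE \<omega> in M. V \<omega> \<noteq> (\<sigma>1 * U \<omega> - b) / \<sigma>2"
    by (rule AE_neq_graph) measurable
  then show ?thesis
    unfolding H g by eventually_elim (rule outperformance_payoff_split[where F="F _", OF s \<sigma> K assms a b])
qed

lemma H_nonneg: "0 \<le> H \<omega>"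
  by (simp add: H)

lemma H_measurable [measurable]: "H \<in> borel_measurable M"
  unfolding H by measurable

text \<open>In the coordinates (x, z) with z = \<sigma>1 x - \<sigma>2 y the comparison of the two
  prices becomes z > b or z < b, so each half lives on a product of half-lines. The eliminated
  variable reappears as (\<sigma>1 x - z)/\<sigma>2, or as (z + \<sigma>2 y)/\<sigma>1 in the second
  half.\<close>

lemma linear_loss_formula:
  "(\<integral>\<omega>. H \<omega> * of_bool (c \<le> exp (A1 * U \<omega> + A2 * V \<omega> + B * T)) \<partial>M) =
      (LBINT x:{a1<..}. (LBINT z:{b<..}.
         g1 x * of_bool (ereal (A1 * x + A2 * ((\<sigma>1 * x - z) / \<sigma>2)) \<ge> eln (ereal c) - ereal (B * T))
           * joint_density M U D x z))
    + (LBINT y:{a2<..}. (LBINT z:{..<b}.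
         g2 y * of_bool (ereal (A1 * ((z + \<sigma>2 * y) / \<sigma>1) + A2 * y) \<ge> eln (ereal c) - ereal (B * T))
           * joint_density M V D y z))"
proof -
  let ?R = "\<lambda>x y. c \<le> exp (A1 * x + A2 * y + B * T)"
  let ?k1 = "\<lambda>x. (\<sigma>1 * x - b) / \<sigma>2" and ?k2 = "\<lambda>y. (\<sigma>2 * y + b) / \<sigma>1"
  let ?F1 = "\<lambda>\<omega>. of_bool (a1 < U \<omega> \<and> V \<omega> < ?k1 (U \<omega>)) * (g1 (U \<omega>) * of_bool (?R (U \<omega>) (V \<omega>)))"
  let ?F2 = "\<lambda>\<omega>. of_bool (a2 < V \<omega> \<and> U \<omega> < ?k2 (V \<omega>)) * (g2 (V \<omega>) * of_bool (?R (U \<omega>) (V \<omega>)))"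
  let ?h1 = "\<lambda>x z. g1 x * of_bool (ereal (A1 * x + A2 * ((\<sigma>1 * x - z) / \<sigma>2)) \<ge> eln (ereal c) - ereal (B * T))"
  let ?h2 = "\<lambda>y z. g2 y * of_bool (ereal (A1 * ((z + \<sigma>2 * y) / \<sigma>1) + A2 * y) \<ge> eln (ereal c) - ereal (B * T))"
  have k: "y < ?k1 x \<longleftrightarrow> b < \<sigma>1 * x - \<sigma>2 * y" "x < ?k2 y \<longleftrightarrow> \<sigma>1 * x - \<sigma>2 * y < b" for x y
    using \<sigma> by (auto simp: field_simps)
  interpret D1: ac_pair M U D
    using ac_pair_shear[of "- \<sigma>2" \<sigma>1] \<sigma> by (simp add: D)
  interpret D2: ac_pair M V D
    using swap.ac_pair_shear[of \<sigma>1 "- \<sigma>2"] \<sigma> by (simp add: D add.commute)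
  have "?F1 = (\<lambda>\<omega>. of_bool (a1 < U \<omega> \<and> V \<omega> < ?k1 (U \<omega>) \<and> ?R (U \<omega>) (V \<omega>)) * g1 (U \<omega>) powr 1)"
    using g_positive(1) by (auto simp: fun_eq_iff powr_one less_imp_le)
  then have i1: "integrable M ?F1"
    using integrable_power_payoff[where a=a1, OF g_measurable(1) g_positive_all(1) g_exp_bound(1), where R="\<lambda>x y. y < ?k1 x \<and> ?R x y" and q=1]
    by simp
  have "?F2 = (\<lambda>\<omega>. of_bool (a2 < V \<omega> \<and> U \<omega> < ?k2 (V \<omega>) \<and> ?R (U \<omega>) (V \<omega>)) * g2 (V \<omega>) powr 1)"
    using g_positive(2) by (auto simp: fun_eq_iff powr_one less_imp_le)
  then have i2: "integrable M ?F2"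
    using swap.integrable_power_payoff[where a=a2, OF g_measurable(2) g_positive_all(2) g_exp_bound(2), where R="\<lambda>y x. x < ?k2 y \<and> ?R x y" and q=1]
    by simp
  have e1: "?F1 = (\<lambda>\<omega>. of_bool (U \<omega> \<in> {a1<..} \<and> D \<omega> \<in> {b<..}) * ?h1 (U \<omega>) (D \<omega>))"
    using \<sigma> by (auto simp: fun_eq_iff D le_exp_iff_eln[OF c] k)
  have e2: "?F2 = (\<lambda>\<omega>. of_bool (V \<omega> \<in> {a2<..} \<and> D \<omega> \<in> {..<b}) * ?h2 (V \<omega>) (D \<omega>))"
    using \<sigma> by (auto simp: fun_eq_iff D le_exp_iff_eln[OF c] k)
  have "(\<integral>\<omega>. H \<omega> * of_bool (?R (U \<omega>) (V \<omega>)) \<partial>M) = (\<integral>\<omega>. ?F1 \<omega> + ?F2 \<omega> \<partial>M)"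
    by (rule integral_cong_AE)
       (measurable, rule AE_payoff_split[of "\<lambda>\<omega> h. h * of_bool (?R (U \<omega>) (V \<omega>))"], simp)
  also have "\<dots> = (\<integral>\<omega>. ?F1 \<omega> \<partial>M) + (\<integral>\<omega>. ?F2 \<omega> \<partial>M)"
    by (rule Bochner_Integration.integral_add[OF i1 i2])
  also have "(\<integral>\<omega>. ?F1 \<omega> \<partial>M) = (LBINT x:{a1<..}. (LBINT z:{b<..}. ?h1 x z * joint_density M U D x z))"
    using i1 unfolding e1 by (intro D1.set_integral_joint_density[symmetric]) measurable
  also have "(\<integral>\<omega>. ?F2 \<omega> \<partial>M) = (LBINT y:{a2<..}. (LBINT z:{..<b}. ?h2 y z * joint_density M V D y z))"
    using i2 unfolding e2 by (intro D2.set_integral_joint_density[symmetric]) measurable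
  finally show ?thesis .
qed

section \<open>The two power-loss formulas\<close>

context
  fixes Z :: "'a \<Rightarrow> real" and p :: real
  assumes Z: "Z = (\<lambda>\<omega>. exp (- A1 * U \<omega> - A2 * V \<omega> - B * T))"
    and p: "p > 1" and A: "A1 > 0" "A2 > 0"
begin

lemma Z_apply: "Z \<omega> = exp (- A1 * U \<omega> - A2 * V \<omega> - B * T)"
  by (simp add: Z)

text \<open>The summands stand in the order produced by the one-asset lemmas for the swapped pair,
  so that folding recognises Z there.\<close>

lemma Z_swap: "Z \<omega> = exp (- A2 * V \<omega> - A1 * U \<omega> - B * T)"
  by (simp add: Z algebra_simps)

lemma Z_measurable [measurable]: "Z \<in> borel_measurable M"
  unfolding Z by measurable

lemma shortfall_formula:
  "Psi1p p M Z H c =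
          1 / p * (LBINT x:{a1<..}.
            (LBINT y:einterval (-\<infinity>) (min (boundary A1 A2 B T p c g1 x) (ereal ((\<sigma>1 * x - b) / \<sigma>2))).
               g1 x powr p * cond_density M V U x y) * rv_density M U x)
        + 1 / p * c powr (p / (p - 1)) * exp (- (p * B * T / (p - 1))) * (LBINT x:{a1<..}.
            (LBINT y:einterval (boundary A1 A2 B T p c g1 x) (ereal ((\<sigma>1 * x - b) / \<sigma>2)).
               exp (- (p * A1 / (p - 1)) * x - p * A2 / (p - 1) * y) * cond_density M V U x y)
            * rv_density M U x)
        + 1 / p * (LBINT x:{a2<..}.
            (LBINT y:einterval (-\<infinity>) (min (boundary A2 A1 B T p c g2 x) (ereal ((\<sigma>2 * x + b) / \<sigma>1))).
               g2 x powr p * cond_density M U V x y) * rv_density M V x)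
        + 1 / p * c powr (p / (p - 1)) * exp (- (p * B * T / (p - 1))) * (LBINT x:{a2<..}.
            (LBINT y:einterval (boundary A2 A1 B T p c g2 x) (ereal ((\<sigma>2 * x + b) / \<sigma>1)).
               exp (- (p * A1 / (p - 1)) * y - p * A2 / (p - 1) * x) * cond_density M U V x y)
            * rv_density M V x)"
proof -
  let ?Y = "\<lambda>\<omega>. (c * Z \<omega>) powr (1 / (p - 1))"
  let ?F1 = "\<lambda>\<omega>. of_bool (a1 < U \<omega> \<and> V \<omega> < (\<sigma>1 * U \<omega> - b) / \<sigma>2) * min (g1 (U \<omega>)) (?Y \<omega>) powr p"
  let ?F2 = "\<lambda>\<omega>. of_bool (a2 < V \<omega> \<and> U \<omega> < (\<sigma>2 * V \<omega> + b) / \<sigma>1) * min (g2 (V \<omega>)) (?Y \<omega>) powr p"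
  have k: "(\<lambda>x. (\<sigma>1 * x - b) / \<sigma>2) \<in> borel_measurable borel" "(\<lambda>x. (\<sigma>2 * x + b) / \<sigma>1) \<in> borel_measurable borel"
    by measurable
  have e: "exp (- (p * A1 / (p - 1)) * y - p * A2 / (p - 1) * x) = exp (- (p * A2 / (p - 1)) * x - p * A1 / (p - 1) * y)"
    for x y by simp
  note 1 = power_shortfall_half[where a=a1 and A=A1 and B=B and T=T,
      OF g_measurable(1) g_positive_all(1) g_exp_bound(1) A(2) p c k(1)]
  note 2 = swap.power_shortfall_half[where a=a2 and A=A2 and B=B and T=T,
      OF g_measurable(2) g_positive_all(2) g_exp_bound(2) A(1) p c k(2)]
  note i1 = 1(1)[folded Z_apply] and i2 = 2(1)[folded Z_swap]
    and r1 = 1(2)[folded Z_apply] and r2 = 2(2)[folded Z_swap e]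
  \<comment> \<open>Where H > 0, multiplying the minimum in \<open>phi\<close> by H gives min(H,
    (cZ)^(1/(p-1))); where H = 0 both sides are 0. The factor \<open>of_bool\<close> makes the
    vanishing at H = 0 explicit, as the splitting lemma requires.\<close>
  have "((1 - phi p Z H c \<omega>) * H \<omega>) powr p = of_bool (0 < H \<omega>) * min (H \<omega>) (?Y \<omega>) powr p" for \<omega>
    using H_nonneg[of \<omega>] by (cases "H \<omega> = 0") (auto simp: phi_def min_def field_simps)
  then have "Psi1p p M Z H c = 1 / p * (\<integral>\<omega>. of_bool (0 < H \<omega>) * min (H \<omega>) (?Y \<omega>) powr p \<partial>M)"
    unfolding Psi1p_def by simp
  also have "(\<integral>\<omega>. of_bool (0 < H \<omega>) * min (H \<omega>) (?Y \<omega>) powr p \<partial>M) = (\<integral>\<omega>. ?F1 \<omega> + ?F2 \<omega> \<partial>M)"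
  proof (rule integral_cong_AE)
    show "AE \<omega> in M. of_bool (0 < H \<omega>) * min (H \<omega>) (?Y \<omega>) powr p = ?F1 \<omega> + ?F2 \<omega>"
      using AE_payoff_split[of "\<lambda>\<omega> h. of_bool (0 < h) * min h (?Y \<omega>) powr p"]
      by (auto elim!: eventually_mono simp: g_positive)
  qed measurable
  also have "\<dots> = (\<integral>\<omega>. ?F1 \<omega> \<partial>M) + (\<integral>\<omega>. ?F2 \<omega> \<partial>M)"
    by (rule Bochner_Integration.integral_add[OF i1 i2])
  also have "1 / p * \<dots> = 1 / p * (\<integral>\<omega>. ?F1 \<omega> \<partial>M) + 1 / p * (\<integral>\<omega>. ?F2 \<omega> \<partial>M)"
    by (rule distrib_left)
  finally show ?thesis
    unfolding r1[symmetric] r2[symmetric] by (simp only: add.assoc)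
qed

lemma hedge_formula:
  "Psi2p p M Z H c =
          (LBINT x:{a1<..}.
            (LBINT y:einterval (boundary A1 A2 B T p c g1 x) (ereal ((\<sigma>1 * x - b) / \<sigma>2)).
               g1 x * cond_density M V U x y) * rv_density M U x)
        - c powr (1 / (p - 1)) * exp (- (B / (p - 1) * T)) * (LBINT x:{a1<..}.
            (LBINT y:einterval (boundary A1 A2 B T p c g1 x) (ereal ((\<sigma>1 * x - b) / \<sigma>2)).
               exp (- (A1 / (p - 1)) * x - A2 / (p - 1) * y) * cond_density M V U x y)
            * rv_density M U x)
        + (LBINT x:{a2<..}.
            (LBINT y:einterval (boundary A2 A1 B T p c g2 x) (ereal ((\<sigma>2 * x + b) / \<sigma>1)).
               g2 x * cond_density M U V x y) * rv_density M V x)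
        - c powr (1 / (p - 1)) * exp (- (B / (p - 1) * T)) * (LBINT x:{a2<..}.
            (LBINT y:einterval (boundary A2 A1 B T p c g2 x) (ereal ((\<sigma>2 * x + b) / \<sigma>1)).
               exp (- (A1 / (p - 1)) * y - A2 / (p - 1) * x) * cond_density M U V x y)
            * rv_density M V x)"
proof -
  let ?Y = "\<lambda>\<omega>. (c * Z \<omega>) powr (1 / (p - 1))"
  let ?F1 = "\<lambda>\<omega>. of_bool (a1 < U \<omega> \<and> V \<omega> < (\<sigma>1 * U \<omega> - b) / \<sigma>2) * max (g1 (U \<omega>) - ?Y \<omega>) 0"
  let ?F2 = "\<lambda>\<omega>. of_bool (a2 < V \<omega> \<and> U \<omega> < (\<sigma>2 * V \<omega> + b) / \<sigma>1) * max (g2 (V \<omega>) - ?Y \<omega>) 0"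
  have k: "(\<lambda>x. (\<sigma>1 * x - b) / \<sigma>2) \<in> borel_measurable borel" "(\<lambda>x. (\<sigma>2 * x + b) / \<sigma>1) \<in> borel_measurable borel"
    by measurable
  have e: "exp (- (A1 / (p - 1)) * y - A2 / (p - 1) * x) = exp (- (A2 / (p - 1)) * x - A1 / (p - 1) * y)"
    for x y by simp
  note 1 = power_hedge_half[where a=a1 and A=A1 and B=B and T=T,
      OF g_measurable(1) g_positive_all(1) g_exp_bound(1) A(2) p c k(1)]
  note 2 = swap.power_hedge_half[where a=a2 and A=A2 and B=B and T=T,
      OF g_measurable(2) g_positive_all(2) g_exp_bound(2) A(1) p c k(2)]
  note i1 = 1(1)[folded Z_apply] and i2 = 2(1)[folded Z_swap]
    and r1 = 1(2)[folded Z_apply] and r2 = 2(2)[folded Z_swap e]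
  \<comment> \<open>H minus min(H, (cZ)^(1/(p-1))) is a positive part; it is also correct at H = 0,
    since the power is nonnegative.\<close>
  have "H \<omega> * phi p Z H c \<omega> = max (H \<omega> - ?Y \<omega>) 0" for \<omega>
    using H_nonneg[of \<omega>] by (cases "H \<omega> = 0") (auto simp: phi_def min_def max_def field_simps)
  then have "Psi2p p M Z H c = (\<integral>\<omega>. max (H \<omega> - ?Y \<omega>) 0 \<partial>M)"
    unfolding Psi2p_def by simp
  also have "\<dots> = (\<integral>\<omega>. ?F1 \<omega> + ?F2 \<omega> \<partial>M)"
    by (rule integral_cong_AE)
       (measurable, rule AE_payoff_split[of "\<lambda>\<omega> h. max (h - ?Y \<omega>) 0"], simp)
  also have "\<dots> = (\<integral>\<omega>. ?F1 \<omega> \<partial>M) + (\<integral>\<omega>. ?F2 \<omega> \<partial>M)"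
    by (rule Bochner_Integration.integral_add[OF i1 i2])
  finally show ?thesis
    unfolding r1[symmetric] r2[symmetric] by (simp only: add_diff_eq)
qed

end

end

end

section \<open>The outperformance option\<close>

theorem mainTheorem7:
  fixes P P' :: "'a measure"
    and W1 W2 S1 S2 :: "real \<Rightarrow> 'a \<Rightarrow> real"
    and V1 V2 X1 X2 D D' Z H :: "'a \<Rightarrow> real"
    and Q :: "real^2^2"
    and \<theta> A :: "real^2"
    and T \<rho> \<alpha>1 \<alpha>2 \<sigma>1 \<sigma>2 r s1 s2 K \<theta>1 \<theta>2 A1 A2 B B' a1 a2 a1' a2' b b' c p :: real
    and g1 g2 g1' g2' :: "real \<Rightarrow> real"
    and v1 v2 v1' v2' :: "real \<Rightarrow> ereal"
  assumes T: "T > 0"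
    and Q: "Q = corr_matrix \<rho>" "pos_def Q"
    and W: "wiener_process_2d P Q T W1 W2"
    and vol: "\<sigma>1 > 0" "\<sigma>2 > 0"
    and init: "s1 > 0" "s2 > 0"
    and S1: "S1 = stock s1 \<alpha>1 \<sigma>1 W1"
    and S2: "S2 = stock s2 \<alpha>2 \<sigma>2 W2"
    and theta: "\<theta>1 = (\<alpha>1 - r) / \<sigma>1" "\<theta>2 = (\<alpha>2 - r) / \<sigma>2" "\<theta> = vector [\<theta>1, \<theta>2]"
    and A: "A = matrix_inv Q *v \<theta>" "A1 = A $ 1" "A2 = A $ 2"
    and B: "B = 1 / 2 * (norm (inv_sqrt_matrix Q *v \<theta>))\<^sup>2"
    and B': "B' = B - A1 * \<theta>1 - A2 * \<theta>2"
    \<comment> \<open>\<open>X1, X2\<close> are $W^1_T, W^2_T$ and \<open>V1, V2\<close> are $\widetilde W^1_T, \widetilde W^2_T$\<close>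
    and X: "X1 = W1 T" "X2 = W2 T"
    and V: "V1 = (\<lambda>\<omega>. W1 T \<omega> + \<theta>1 * T)" "V2 = (\<lambda>\<omega>. W2 T \<omega> + \<theta>2 * T)"
    and D: "D = (\<lambda>\<omega>. \<sigma>1 * X1 \<omega> - \<sigma>2 * X2 \<omega>)"
    and D': "D' = (\<lambda>\<omega>. \<sigma>1 * V1 \<omega> - \<sigma>2 * V2 \<omega>)"
    and Z: "Z = (\<lambda>\<omega>. exp (- A1 * W1 T \<omega> - A2 * W2 T \<omega> - B * T))"
    and P': "P' = density P (\<lambda>\<omega>. ennreal (Z \<omega>))"
    and K: "K > 0"
    and H: "H = (\<lambda>\<omega>. max (max (S1 T \<omega>) (S2 T \<omega>) - K) 0)"
    and a: "a1 = 1 / \<sigma>1 * (ln (K / s1) - (\<alpha>1 - \<sigma>1\<^sup>2 / 2) * T)"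
           "a2 = 1 / \<sigma>2 * (ln (K / s2) - (\<alpha>2 - \<sigma>2\<^sup>2 / 2) * T)"
    and a': "a1' = 1 / \<sigma>1 * (ln (K / s1) - (r - \<sigma>1\<^sup>2 / 2) * T)"
            "a2' = 1 / \<sigma>2 * (ln (K / s2) - (r - \<sigma>2\<^sup>2 / 2) * T)"
    and b: "b = ln (s2 / s1) + (\<alpha>2 - \<alpha>1 - (\<sigma>2\<^sup>2 - \<sigma>1\<^sup>2) / 2) * T"
    and b': "b' = ln (s2 / s1) - (\<sigma>2\<^sup>2 - \<sigma>1\<^sup>2) / 2 * T"
    and g: "g1 = (\<lambda>x. bs_price s1 \<alpha>1 \<sigma>1 T x - K)" "g2 = (\<lambda>x. bs_price s2 \<alpha>2 \<sigma>2 T x - K)"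
    and g': "g1' = (\<lambda>x. bs_price s1 r \<sigma>1 T x - K)" "g2' = (\<lambda>x. bs_price s2 r \<sigma>2 T x - K)"
    and v: "v1 = boundary A1 A2 B T p c g1" "v2 = boundary A2 A1 B T p c g2"
    and v': "v1' = boundary A1 A2 B' T p c g1'" "v2' = boundary A2 A1 B' T p c g2'"
    and c: "c \<ge> 0"
  shows
   "Psi1 P Z H c =
      (LBINT x:{a1<..}. (LBINT z:{b<..}.
         g1 x * of_bool (ereal (A1 * x + A2 * ((\<sigma>1 * x - z) / \<sigma>2)) \<ge> eln (ereal c) - ereal (B * T))
           * joint_density P X1 D x z))
    + (LBINT y:{a2<..}. (LBINT z:{..<b}.
         g2 y * of_bool (ereal (A1 * ((z + \<sigma>2 * y) / \<sigma>1) + A2 * y) \<ge> eln (ereal c) - ereal (B * T))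
           * joint_density P X2 D y z))
  \<and> Psi2 P' Z H c =
      (LBINT x:{a1'<..}. (LBINT z:{b'<..}.
         g1' x * of_bool (ereal (A1 * x + A2 * ((\<sigma>1 * x - z) / \<sigma>2)) \<ge> eln (ereal c) - ereal (B' * T))
           * joint_density P' V1 D' x z))
    + (LBINT y:{a2'<..}. (LBINT z:{..<b'}.
         g2' y * of_bool (ereal (A1 * ((z + \<sigma>2 * y) / \<sigma>1) + A2 * y) \<ge> eln (ereal c) - ereal (B' * T))
           * joint_density P' V2 D' y z))
  \<and> (p > 1 \<and> A1 > 0 \<and> A2 > 0 \<longrightarrow>
      Psi1p p P Z H c =
          1 / p * (LBINT x:{a1<..}.
            (LBINT y:einterval (-\<infinity>) (min (v1 x) (ereal ((\<sigma>1 * x - b) / \<sigma>2))).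
               g1 x powr p * cond_density P X2 X1 x y) * rv_density P X1 x)
        + 1 / p * c powr (p / (p - 1)) * exp (- (p * B * T / (p - 1))) * (LBINT x:{a1<..}.
            (LBINT y:einterval (v1 x) (ereal ((\<sigma>1 * x - b) / \<sigma>2)).
               exp (- (p * A1 / (p - 1)) * x - p * A2 / (p - 1) * y) * cond_density P X2 X1 x y)
            * rv_density P X1 x)
        + 1 / p * (LBINT x:{a2<..}.
            (LBINT y:einterval (-\<infinity>) (min (v2 x) (ereal ((\<sigma>2 * x + b) / \<sigma>1))).
               g2 x powr p * cond_density P X1 X2 x y) * rv_density P X2 x)
        + 1 / p * c powr (p / (p - 1)) * exp (- (p * B * T / (p - 1))) * (LBINT x:{a2<..}.
            (LBINT y:einterval (v2 x) (ereal ((\<sigma>2 * x + b) / \<sigma>1)).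
               exp (- (p * A1 / (p - 1)) * y - p * A2 / (p - 1) * x) * cond_density P X1 X2 x y)
            * rv_density P X2 x)
    \<and> Psi2p p P' Z H c =
          (LBINT x:{a1'<..}.
            (LBINT y:einterval (v1' x) (ereal ((\<sigma>1 * x - b') / \<sigma>2)).
               g1' x * cond_density P' V2 V1 x y) * rv_density P' V1 x)
        - c powr (1 / (p - 1)) * exp (- (B' / (p - 1) * T)) * (LBINT x:{a1'<..}.
            (LBINT y:einterval (v1' x) (ereal ((\<sigma>1 * x - b') / \<sigma>2)).
               exp (- (A1 / (p - 1)) * x - A2 / (p - 1) * y) * cond_density P' V2 V1 x y)
            * rv_density P' V1 x)
        + (LBINT x:{a2'<..}.
            (LBINT y:einterval (v2' x) (ereal ((\<sigma>2 * x + b') / \<sigma>1)).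
               g2' x * cond_density P' V1 V2 x y) * rv_density P' V2 x)
        - c powr (1 / (p - 1)) * exp (- (B' / (p - 1) * T)) * (LBINT x:{a2'<..}.
            (LBINT y:einterval (v2' x) (ereal ((\<sigma>2 * x + b') / \<sigma>1)).
               exp (- (A1 / (p - 1)) * y - A2 / (p - 1) * x) * cond_density P' V1 V2 x y)
            * rv_density P' V2 x))"
proof -
  have *: "P' = density P (\<lambda>\<omega>. ennreal (exp (- A1 * X1 \<omega> + - A2 * X2 \<omega> + - B * T)))"
    by (simp add: P' Z X)
  interpret X: exp_ac_pair P X1 X2
    unfolding X using wiener_process_exp_ac_pair T Q W by blast
  interpret V: exp_ac_pair P' V1 V2
    unfolding * V X[symmetric] by (rule X.exp_ac_pair_translate_density)
  have Z_X: "Z = (\<lambda>\<omega>. exp (- A1 * X1 \<omega> - A2 * X2 \<omega> - B * T))"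
    by (simp add: Z X)
  \<comment> \<open>Substituting W = V - \<theta> T adds (A1 \<theta>1 + A2 \<theta>2) T to the
    exponent, which turns B into B'.\<close>
  have Z_V: "Z = (\<lambda>\<omega>. exp (- A1 * V1 \<omega> - A2 * V2 \<omega> - B' * T))"
    by (simp add: Z V B' algebra_simps)
  have S_X: "S1 T = (\<lambda>\<omega>. bs_price s1 \<alpha>1 \<sigma>1 T (X1 \<omega>))" "S2 T = (\<lambda>\<omega>. bs_price s2 \<alpha>2 \<sigma>2 T (X2 \<omega>))"
    by (auto simp: S1 S2 X stock_def)
  \<comment> \<open>The shift contributes \<sigma> \<theta> = \<alpha> - r to the drift, so \<alpha>
    is replaced by r.\<close>
  have S_V: "S1 T = (\<lambda>\<omega>. bs_price s1 r \<sigma>1 T (V1 \<omega>))" "S2 T = (\<lambda>\<omega>. bs_price s2 r \<sigma>2 T (V2 \<omega>))"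
    using vol by (auto simp: S1 S2 V stock_def bs_price_def theta field_simps)
  have H_X: "H = (\<lambda>\<omega>. max (max (bs_price s1 \<alpha>1 \<sigma>1 T (X1 \<omega>)) (bs_price s2 \<alpha>2 \<sigma>2 T (X2 \<omega>)) - K) 0)"
    by (simp add: H S_X)
  have H_V: "H = (\<lambda>\<omega>. max (max (bs_price s1 r \<sigma>1 T (V1 \<omega>)) (bs_price s2 r \<sigma>2 T (V2 \<omega>)) - K) 0)"
    by (simp add: H S_V)
  \<comment> \<open>The generic constant b with both drifts equal to r, whose difference
    cancels.\<close>
  have b'_r: "b' = ln (s2 / s1) + (r - r - (\<sigma>2\<^sup>2 - \<sigma>1\<^sup>2) / 2) * T"
    by (simp add: b')
  have inv_X: "indicator {\<omega>. c \<le> inverse (Z \<omega>)} \<omega> = (of_bool (c \<le> exp (A1 * X1 \<omega> + A2 * X2 \<omega> + B * T)) :: real)" for \<omega>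
    by (simp add: Z_X indicator_def exp_minus[symmetric] algebra_simps)
  have inv_V: "indicator {\<omega>. c \<le> inverse (Z \<omega>)} \<omega> = (of_bool (c \<le> exp (A1 * V1 \<omega> + A2 * V2 \<omega> + B' * T)) :: real)" for \<omega>
    by (simp add: Z_V indicator_def exp_minus[symmetric] algebra_simps)
  note X_facts = init vol K a b g D H_X c
  note V_facts = init vol K a' b'_r g' D' H_V c
  have "Psi1 P Z H c = (\<integral>\<omega>. H \<omega> * of_bool (c \<le> exp (A1 * X1 \<omega> + A2 * X2 \<omega> + B * T)) \<partial>P)"
    unfolding Psi1_def inv_X ..
  moreover have "Psi2 P' Z H c = (\<integral>\<omega>. H \<omega> * of_bool (c \<le> exp (A1 * V1 \<omega> + A2 * V2 \<omega> + B' * T)) \<partial>P')"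
    unfolding Psi2_def inv_V ..
  ultimately show ?thesis
    unfolding v v' using X.linear_loss_formula[OF X_facts] V.linear_loss_formula[OF V_facts]
      X.shortfall_formula[OF X_facts Z_X] V.hedge_formula[OF V_facts Z_V]
    by (intro conjI impI) (simp_all only:)
qed

end
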